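(* Let $D\subset\mathbb C$ be a bounded convex domain and let $\Phi:\mathbb D\to D$ be a biholomorphic map with $\Phi(0)=0$ and $|\Phi'(0)|=M_D(0)$. Then there exist $\theta\in\mathbb R$, $c>0$ and $a,\lambda\in\mathbb C$ with $|\lambda|<1$ and $|a-\bar a\lambda|<1-|\lambda|^2$ (equivalently, $1+az+\lambda z^2$ has no zeros on $\overline{\mathbb D}$) such that $F:=e^{i\theta}\Phi$ satisfies $F(0)=0$ and \[ F'(z)=\frac{c}{1+az+\lambda z^2},\qquad z\in\mathbb D. \]
   Context: $\mathbb D=\{z\in\mathbb C:|z|<1\}$. For a domain $D\subset\mathbb C$ and $p\in D$, $M_D(p)$ denotes the supremum of the operator norms $\|df_0\|$ over all harmonic maps $f:\mathbb D\to D$ with $f(0)=p$ whose differential $df_0:\mathbb R^2\to\mathbb R^2$ at $0$ is conformal (i.e. a nonnegative multiple of an orthogonal linear map, orientation preserving or reversing). *)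

theory Defs
  imports "HOL-Complex_Analysis.Complex_Analysis"
begin

definition dmap :: "(complex \<Rightarrow> complex) \<Rightarrow> complex \<Rightarrow> complex \<Rightarrow> complex" where
  "dmap f x = frechet_derivative f (at x)"

definition harmonic_on :: "(complex \<Rightarrow> complex) \<Rightarrow> complex set \<Rightarrow> bool" where
  "harmonic_on f S \<longleftrightarrow> open S \<and>
     (\<forall>x\<in>S. f differentiable at x) \<and>
     (\<forall>u. \<forall>x\<in>S. (\<lambda>y. dmap f y u) differentiable at x) \<and>
     (\<forall>u v. continuous_on S (\<lambda>x. dmap (\<lambda>y. dmap f y u) x v)) \<and>
     (\<forall>x\<in>S. dmap (\<lambda>y. dmap f y 1) x 1 + dmap (\<lambda>y. dmap f y \<i>) x \<i> = 0)"

definition conformal_linear :: "(complex \<Rightarrow> complex) \<Rightarrow> bool" where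
  "conformal_linear L \<longleftrightarrow> (\<exists>r\<ge>0. \<exists>T. orthogonal_transformation T \<and> L = (\<lambda>v. r *\<^sub>R T v))"

definition M_dom :: "complex set \<Rightarrow> complex \<Rightarrow> real" where
  "M_dom D p = Sup {onorm (dmap f 0) | f. harmonic_on f (ball 0 1) \<and> f ` ball 0 1 \<subseteq> D
                      \<and> f 0 = p \<and> conformal_linear (dmap f 0)}"

end

theory Submission
  imports Defs
begin

text \<open>Harmonic maps of the disc into a convex domain form a convex set, and the constraints
  \<open>f(0) = 0\<close> and conformality of \<open>df\<^sub>0\<close> are implied by two linear conditions on the Fourier coefficients
  \<open>a\<^sub>0\<close> and \<open>a\<^sub>-\<^sub>1\<close>. Extremality of \<open>\<Phi>\<close> therefore yields Lagrange multipliers: \<open>\<Phi>\<close> maximises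
  \<open>Re (\<gamma>\<^sub>1 a\<^sub>1 + \<gamma>\<^sub>0 a\<^sub>0 + \<gamma>\<^sub>2 a\<^sub>-\<^sub>1)\<close> among all harmonic maps into the domain, with \<open>\<gamma>\<^sub>1 \<noteq> 0\<close>.
  Comparing \<open>\<Phi>\<close> with the harmonic extension of the boundary values
  \<open>(1 - \<mu>) \<Phi>(z) + \<mu> \<Phi>(e\<^sup>i\<^sup>s z)\<close>, where \<open>\<mu> = (1 + Re (\<kappa> z\<^sup>n)) / 2\<close>, and differentiating at \<open>s = 0\<close>
  shows that the \<open>n\<close>-th Taylor coefficient of \<open>\<Phi>' \<cdot> (\<gamma>\<^sub>1 + \<gamma>\<^sub>0 z + \<gamma>\<^sub>2 z\<^sup>2)\<close> vanishes for \<open>n \<ge> 1\<close>.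
  A zero of the quadratic in the closed disc would contradict the boundedness of \<open>\<Phi>\<close>.\<close>

section \<open>Complex harmonic functions\<close>

lemma has_derivative_along_line:
  fixes u :: "'a::real_normed_vector \<Rightarrow> real"
  assumes "(u has_derivative L) (at (p + a *\<^sub>R v))"
  shows "((\<lambda>s. u (p + s *\<^sub>R v)) has_real_derivative L v) (at a)"
proof -
  have "((\<lambda>s. p + s *\<^sub>R v) has_derivative (\<lambda>s. s *\<^sub>R v)) (at a)"
    by (auto intro!: derivative_eq_intros)
  then have "((\<lambda>s. u (p + s *\<^sub>R v)) has_derivative (\<lambda>s. L (s *\<^sub>R v))) (at a)"
    using has_derivative_compose assms by fastforce
  moreover have "(\<lambda>s. L (s *\<^sub>R v)) = (*) (L v)"
    using linear_cmul[OF has_derivative_linear[OF assms]] by (auto simp: fun_eq_iff)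
  ultimately show ?thesis
    by (simp add: has_field_derivative_def)
qed

text \<open>Two uses of the mean value theorem: along \<open>v\<close> for the increment of
  \<open>u\<close> in direction \<open>w\<close>, then along \<open>w\<close> for the first
  derivative that results.\<close>

lemma second_difference_mean_value:
  fixes u :: "'a::real_normed_vector \<Rightarrow> real"
  assumes "0 < t"
    and sub: "\<And>a b. a \<in> {0..t} \<Longrightarrow> b \<in> {0..t} \<Longrightarrow> x + a *\<^sub>R v + b *\<^sub>R w \<in> S"
    and du: "\<And>y. y \<in> S \<Longrightarrow> (u has_derivative u' y) (at y)"
    and ddu: "\<And>y. y \<in> S \<Longrightarrow> ((\<lambda>y. u' y v) has_derivative u'' y) (at y)"
  shows "\<exists>a\<in>{0..t}. \<exists>b\<in>{0..t}.
    u (x + t *\<^sub>R v + t *\<^sub>R w) - u (x + t *\<^sub>R v) - u (x + t *\<^sub>R w) + u x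
      = t * (t * u'' (x + a *\<^sub>R v + b *\<^sub>R w) w)"
proof -
  let ?D = "\<lambda>s. u (x + t *\<^sub>R w + s *\<^sub>R v) - u (x + s *\<^sub>R v)"
  have "(?D has_real_derivative u' (x + t *\<^sub>R w + a *\<^sub>R v) v - u' (x + a *\<^sub>R v) v) (at a)"
    if "0 \<le> a" "a \<le> t" for a
    using sub[of a t] sub[of a 0] that \<open>0 < t\<close>
    by (intro DERIV_diff has_derivative_along_line du) (auto simp: algebra_simps)
  from MVT2[OF \<open>0 < t\<close> this] obtain a where a: "0 < a" "a < t"
    and D: "?D t - ?D 0 = t * (u' (x + t *\<^sub>R w + a *\<^sub>R v) v - u' (x + a *\<^sub>R v) v)"
    by auto
  have "((\<lambda>s. u' (x + a *\<^sub>R v + s *\<^sub>R w) v) has_real_derivative u'' (x + a *\<^sub>R v + b *\<^sub>R w) w) (at b)"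
    if "0 \<le> b" "b \<le> t" for b
    using sub[of a b] that a by (intro has_derivative_along_line[where u="\<lambda>y. u' y v"] ddu) auto
  from MVT2[OF \<open>0 < t\<close> this] obtain b where b: "0 < b" "b < t"
    and E: "u' (x + a *\<^sub>R v + t *\<^sub>R w) v - u' (x + a *\<^sub>R v + 0 *\<^sub>R w) v = t * u'' (x + a *\<^sub>R v + b *\<^sub>R w) w"
    by auto
  have "u (x + t *\<^sub>R v + t *\<^sub>R w) - u (x + t *\<^sub>R v) - u (x + t *\<^sub>R w) + u x
      = t * (t * u'' (x + a *\<^sub>R v + b *\<^sub>R w) w)"
    using D E by (simp add: add.commute add.left_commute)
  with a b show ?thesis
    by (meson atLeastAtMost_iff less_imp_le)
qed

text \<open>The second difference over a parallelogram is symmetric in \<open>v\<close> and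
  \<open>w\<close>, so the two mixed derivatives share a value, taken at possibly different points
  of it. Shrinking the parallelogram and continuity finish the argument.\<close>

lemma mixed_derivatives_commute:
  fixes u :: "'a::real_normed_vector \<Rightarrow> real"
  assumes "open S" "x \<in> S"
    and du: "\<And>y. y \<in> S \<Longrightarrow> (u has_derivative u' y) (at y)"
    and dv: "\<And>y. y \<in> S \<Longrightarrow> ((\<lambda>y. u' y v) has_derivative V y) (at y)"
    and dw: "\<And>y. y \<in> S \<Longrightarrow> ((\<lambda>y. u' y w) has_derivative W y) (at y)"
    and cV: "continuous_on S (\<lambda>y. V y w)" and cW: "continuous_on S (\<lambda>y. W y v)"
  shows "V x w = W x v"
proof (rule ccontr)
  assume "V x w \<noteq> W x v"
  define e where "e = \<bar>V x w - W x v\<bar> / 2"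
  have "e > 0" using \<open>V x w \<noteq> W x v\<close> by (simp add: e_def)
  have "isCont (\<lambda>y. V y w) x" "isCont (\<lambda>y. W y v) x"
    using cV cW assms(1,2) by (auto simp: continuous_on_eq_continuous_at)
  then obtain d1 d2 where d1: "d1 > 0" "\<And>y. dist y x < d1 \<Longrightarrow> dist (V y w) (V x w) < e"
    and d2: "d2 > 0" "\<And>y. dist y x < d2 \<Longrightarrow> dist (W y v) (W x v) < e"
    using \<open>e > 0\<close> unfolding continuous_at_eps_delta by metis
  obtain d3 where d3: "d3 > 0" "ball x d3 \<subseteq> S"
    using assms(1,2) by (auto elim: openE)
  define d where "d = min d1 (min d2 d3)"
  \<comment> \<open>This side length keeps the parallelogram within distance \<open>d\<close> of
    \<open>x\<close>; the summand 1 covers \<open>v = w = 0\<close>.\<close>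
  define t where "t = d / (norm v + norm w + 1)"
  have pos: "norm v + norm w + 1 > 0"
    using norm_ge_zero[of v] norm_ge_zero[of w] by linarith
  have "d > 0" using d1 d2 d3 by (simp add: d_def)
  then have "t > 0" using pos by (simp add: t_def)
  have near: "dist (x + a *\<^sub>R v + b *\<^sub>R w) x < d" if "a \<in> {0..t}" "b \<in> {0..t}" for a b
  proof -
    have "dist (x + a *\<^sub>R v + b *\<^sub>R w) x = norm (a *\<^sub>R v + b *\<^sub>R w)"
      by (simp add: dist_norm algebra_simps)
    also have "\<dots> \<le> a * norm v + b * norm w"
      using that by (intro norm_triangle_le) auto
    also have "\<dots> \<le> t * norm v + t * norm w"
      using that by (intro add_mono mult_right_mono) auto
    also have "\<dots> < t * (norm v + norm w + 1)"
      using \<open>t > 0\<close> by (simp add: algebra_simps)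
    also have "\<dots> = d" using pos by (simp add: t_def)
    finally show ?thesis .
  qed
  have sub: "x + a *\<^sub>R v + b *\<^sub>R w \<in> S" if "a \<in> {0..t}" "b \<in> {0..t}" for a b
    using near[OF that] d3 by (auto simp: d_def dist_commute)
  have sub': "x + a *\<^sub>R w + b *\<^sub>R v \<in> S" if "a \<in> {0..t}" "b \<in> {0..t}" for a b
    using sub[OF that(2,1)] by (simp add: add.commute add.left_commute)
  obtain a b where ab: "a \<in> {0..t}" "b \<in> {0..t}" and
    1: "u (x + t *\<^sub>R v + t *\<^sub>R w) - u (x + t *\<^sub>R v) - u (x + t *\<^sub>R w) + u x
      = t * (t * V (x + a *\<^sub>R v + b *\<^sub>R w) w)"
    using second_difference_mean_value[OF \<open>t > 0\<close> sub du dv] by blast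
  obtain a' b' where ab': "a' \<in> {0..t}" "b' \<in> {0..t}" and
    2: "u (x + t *\<^sub>R w + t *\<^sub>R v) - u (x + t *\<^sub>R w) - u (x + t *\<^sub>R v) + u x
      = t * (t * W (x + a' *\<^sub>R w + b' *\<^sub>R v) v)"
    using second_difference_mean_value[OF \<open>t > 0\<close> sub' du dw] by blast
  have eq: "x + t *\<^sub>R w + t *\<^sub>R v = x + t *\<^sub>R v + t *\<^sub>R w" by (simp add: algebra_simps)
  have "t * (t * V (x + a *\<^sub>R v + b *\<^sub>R w) w) = t * (t * W (x + a' *\<^sub>R w + b' *\<^sub>R v) v)"
    using 1 2 unfolding eq by linarith
  then have "V (x + a *\<^sub>R v + b *\<^sub>R w) w = W (x + a' *\<^sub>R w + b' *\<^sub>R v) v"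
    using \<open>t > 0\<close> by simp
  moreover have "dist (V (x + a *\<^sub>R v + b *\<^sub>R w) w) (V x w) < e"
    using near[OF ab] by (intro d1) (auto simp: d_def)
  moreover have "dist (W (x + a' *\<^sub>R w + b' *\<^sub>R v) v) (W x v) < e"
    using near[OF ab'(2,1)] by (intro d2) (auto simp: d_def add.commute add.left_commute)
  ultimately show False
    by (simp add: dist_real_def e_def abs_if split: if_splits)
qed

section \<open>Harmonic maps as sums of a holomorphic and an antiholomorphic function\<close>

text \<open>In this form the Fourier coefficients of index 1 and -1 are \<open>deriv h 0\<close> and
  \<open>cnj (deriv g 0)\<close>, and holomorphic tools apply to each summand.\<close>

definition harmonic_sum :: "(complex \<Rightarrow> complex) \<Rightarrow> (complex \<Rightarrow> complex) \<Rightarrow> complex \<Rightarrow> complex" where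
  "harmonic_sum h g z = h z + cnj (g z)"

lemma has_derivative_harmonic_sum:
  assumes "h holomorphic_on S" "g holomorphic_on S" "open S" "z \<in> S"
  shows "(harmonic_sum h g has_derivative (\<lambda>v. deriv h z * v + cnj (deriv g z * v))) (at z)"
proof -
  have "(h has_derivative (*) (deriv h z)) (at z)" "(g has_derivative (*) (deriv g z)) (at z)"
    using assms holomorphic_derivI by (auto simp: has_field_derivative_def)
  then show ?thesis
    unfolding harmonic_sum_def[abs_def] by (intro derivative_intros)
qed

lemma dmap_harmonic_sum:
  assumes "h holomorphic_on S" "g holomorphic_on S" "open S" "z \<in> S"
  shows "dmap (harmonic_sum h g) z = (\<lambda>v. deriv h z * v + cnj (deriv g z * v))"
  unfolding dmap_def using frechet_derivative_at[OF has_derivative_harmonic_sum[OF assms]] by simp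

lemma dmap_dmap_harmonic_sum:
  assumes "h holomorphic_on S" "g holomorphic_on S" "open S" "z \<in> S"
  shows "((\<lambda>y. dmap (harmonic_sum h g) y u) has_derivative
            (\<lambda>v. deriv (deriv h) z * u * v + cnj (deriv (deriv g) z * u * v))) (at z)"
proof -
  have "(harmonic_sum (\<lambda>y. deriv h y * u) (\<lambda>y. deriv g y * u) has_derivative
         (\<lambda>v. deriv (\<lambda>y. deriv h y * u) z * v + cnj (deriv (\<lambda>y. deriv g y * u) z * v))) (at z)"
    using assms by (intro has_derivative_harmonic_sum[where S=S] holomorphic_intros holomorphic_deriv)
  moreover have "deriv (\<lambda>y. deriv h y * u) z = deriv (deriv h) z * u"
    "deriv (\<lambda>y. deriv g y * u) z = deriv (deriv g) z * u"
    using assms holomorphic_derivI[OF holomorphic_deriv, of _ S z]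
    by (auto intro!: DERIV_imp_deriv DERIV_cmult_right)
  ultimately have "(harmonic_sum (\<lambda>y. deriv h y * u) (\<lambda>y. deriv g y * u) has_derivative
         (\<lambda>v. deriv (deriv h) z * u * v + cnj (deriv (deriv g) z * u * v))) (at z)" by simp
  then show ?thesis
    by (rule has_derivative_transform_within_open[OF _ \<open>open S\<close> \<open>z \<in> S\<close>])
       (simp add: dmap_harmonic_sum[OF assms(1-3)] harmonic_sum_def)
qed

lemma harmonic_on_harmonic_sum:
  assumes "h holomorphic_on S" "g holomorphic_on S" "open S"
  shows "harmonic_on (harmonic_sum h g) S"
proof -
  have dd: "dmap (\<lambda>y. dmap (harmonic_sum h g) y u) z
      = (\<lambda>v. deriv (deriv h) z * u * v + cnj (deriv (deriv g) z * u * v))" if "z \<in> S" for u z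
    using frechet_derivative_at[OF dmap_dmap_harmonic_sum[OF assms that]]
    by (simp add: dmap_def[of "\<lambda>y. dmap (harmonic_sum h g) y u"])
  have "continuous_on S (deriv (deriv h))" "continuous_on S (deriv (deriv g))"
    using assms by (simp_all add: holomorphic_deriv holomorphic_on_imp_continuous_on)
  then have "continuous_on S (\<lambda>x. deriv (deriv h) x * u * v + cnj (deriv (deriv g) x * u * v))" for u v
    by (intro continuous_intros)
  then have "continuous_on S (\<lambda>x. dmap (\<lambda>y. dmap (harmonic_sum h g) y u) x v)" for u v
    by (rule continuous_on_eq) (simp add: dd)
  then show ?thesis
    unfolding harmonic_on_def
  proof (intro conjI allI ballI)
    fix z u assume z: "z \<in> S"
    show "harmonic_sum h g differentiable at z"
      using has_derivative_harmonic_sum[OF assms z] by (rule differentiableI)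
    show "(\<lambda>y. dmap (harmonic_sum h g) y u) differentiable at z"
      using dmap_dmap_harmonic_sum[OF assms z] by (rule differentiableI)
    show "dmap (\<lambda>y. dmap (harmonic_sum h g) y 1) z 1 + dmap (\<lambda>y. dmap (harmonic_sum h g) y \<i>) z \<i> = 0"
      by (simp add: dd[OF z] mult.assoc)
  qed (use assms in auto)
qed

text \<open>The last hypothesis is the pair of Cauchy-Riemann equations in one complex equation: it
  makes the real-linear \<open>L z\<close> complex linear.\<close>

lemma holomorphic_on_CauchyRiemann:
  assumes "open S"
    and "\<And>z. z \<in> S \<Longrightarrow> (f has_derivative L z) (at z)"
    and "\<And>z. z \<in> S \<Longrightarrow> L z \<i> = \<i> * L z 1"
  shows "f holomorphic_on S"
proof -
  have "(f has_field_derivative L z 1) (at z)" if "z \<in> S" for z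
  proof -
    have lin: "linear (L z)" using assms(2)[OF that] by (rule has_derivative_linear)
    have "L z v = L z 1 * v" for v
    proof -
      have "L z v = L z (Re v *\<^sub>R 1 + Im v *\<^sub>R \<i>)"
        by (metis complex_eq mult.commute scaleR_conv_of_real mult.right_neutral)
      also have "\<dots> = L z 1 * v"
        using assms(3)[OF that]
        by (simp add: linear_add[OF lin] linear_cmul[OF lin] complex_eq_iff)
      finally show ?thesis .
    qed
    then have "L z = (*) (L z 1)" by (rule ext)
    then show ?thesis
      unfolding has_field_derivative_def by (rule has_derivative_eq_rhs[OF assms(2)[OF that]])
  qed
  then show ?thesis
    using \<open>open S\<close> by (auto simp: holomorphic_on_open)
qed

text \<open>The Wirtinger derivative of \<open>f\<close> in \<open>z\<close> and the conjugate of
  the one in \<open>cnj z\<close> are holomorphic, by the Laplace equation and the symmetry of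
  second derivatives. Their primitives on the disc are \<open>h\<close> and \<open>g\<close>, up to
  a constant.\<close>

lemma harmonic_on_ball_decomposition:
  assumes f: "harmonic_on f (ball 0 1)"
  obtains h g where "h holomorphic_on ball 0 1" "g holomorphic_on ball 0 1"
    "\<And>z. z \<in> ball 0 1 \<Longrightarrow> f z = harmonic_sum h g z"
    "dmap f 0 = (\<lambda>v. deriv h 0 * v + cnj (deriv g 0 * v))"
proof -
  let ?B = "ball (0::complex) 1"
  define fx where "fx = (\<lambda>y. dmap f y 1)"
  define fy where "fy = (\<lambda>y. dmap f y \<i>)"
  have d1: "(f has_derivative dmap f z) (at z)" if "z \<in> ?B" for z
    using f that by (simp add: harmonic_on_def dmap_def flip: frechet_derivative_works)
  have d2: "((\<lambda>y. dmap f y u) has_derivative dmap (\<lambda>y. dmap f y u) z) (at z)" if "z \<in> ?B" for z u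
    using f that by (simp add: harmonic_on_def dmap_def[of "\<lambda>y. dmap f y u"] flip: frechet_derivative_works)
  have c2: "continuous_on ?B (\<lambda>x. dmap (\<lambda>y. dmap f y u) x v)" for u v
    using f by (simp add: harmonic_on_def)
  have sym: "dmap fx z \<i> = dmap fy z 1" if z: "z \<in> ?B" for z
  proof (rule complex_eqI)
    show "Re (dmap fx z \<i>) = Re (dmap fy z 1)"
      unfolding fx_def fy_def
      using z d1 d2 c2
      by (intro mixed_derivatives_commute[where S="?B" and u="\<lambda>y. Re (f y)" and u'="\<lambda>y v. Re (dmap f y v)"
            and V="\<lambda>z v. Re (dmap (\<lambda>y. dmap f y 1) z v)" and W="\<lambda>z v. Re (dmap (\<lambda>y. dmap f y \<i>) z v)"]
          has_derivative_Re continuous_on_Re) simp_all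
    show "Im (dmap fx z \<i>) = Im (dmap fy z 1)"
      unfolding fx_def fy_def
      using z d1 d2 c2
      by (intro mixed_derivatives_commute[where S="?B" and u="\<lambda>y. Im (f y)" and u'="\<lambda>y v. Im (dmap f y v)"
            and V="\<lambda>z v. Im (dmap (\<lambda>y. dmap f y 1) z v)" and W="\<lambda>z v. Im (dmap (\<lambda>y. dmap f y \<i>) z v)"]
          has_derivative_Im continuous_on_Im) simp_all
  qed
  have lap: "dmap fy z \<i> = - dmap fx z 1" if "z \<in> ?B" for z
    using f that by (simp add: harmonic_on_def fx_def fy_def eq_neg_iff_add_eq_0 add.commute)
  have dx: "(fx has_derivative dmap fx z) (at z)" and dy: "(fy has_derivative dmap fy z) (at z)"
    if "z \<in> ?B" for z
    unfolding fx_def fy_def using d2[OF that] by blast+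
  \<comment> \<open>\<open>p\<close> is the derivative of \<open>f\<close> in \<open>z\<close>, and
    \<open>q\<close> the conjugate of its derivative in \<open>cnj z\<close>.\<close>
  define p where "p = (\<lambda>z. (fx z - \<i> * fy z) / 2)"
  define q where "q = (\<lambda>z. (cnj (fx z) - \<i> * cnj (fy z)) / 2)"
  have "(p has_derivative (\<lambda>v. (dmap fx z v - \<i> * dmap fy z v) / 2)) (at z)" if "z \<in> ?B" for z
    unfolding p_def by (auto intro!: derivative_eq_intros dx[OF that] dy[OF that])
  then have "p holomorphic_on ?B"
    by (rule holomorphic_on_CauchyRiemann[OF open_ball]) (auto simp: sym lap algebra_simps)
  have "(q has_derivative (\<lambda>v. (cnj (dmap fx z v) - \<i> * cnj (dmap fy z v)) / 2)) (at z)" if "z \<in> ?B" for z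
    unfolding q_def by (auto intro!: derivative_eq_intros dx[OF that] dy[OF that])
  then have "q holomorphic_on ?B"
    by (rule holomorphic_on_CauchyRiemann[OF open_ball]) (auto simp: sym lap algebra_simps)
  obtain h0 where h0: "\<And>z. z \<in> ?B \<Longrightarrow> (h0 has_field_derivative p z) (at z)"
    using holomorphic_convex_primitive'[OF convex_ball open_ball \<open>p holomorphic_on ?B\<close>]
    by (metis at_within_open open_ball)
  obtain g where g: "\<And>z. z \<in> ?B \<Longrightarrow> (g has_field_derivative q z) (at z)"
    using holomorphic_convex_primitive'[OF convex_ball open_ball \<open>q holomorphic_on ?B\<close>]
    by (metis at_within_open open_ball)
  have df: "dmap f z v = p z * v + cnj (q z * v)" if "z \<in> ?B" for z v
  proof -
    have lin: "linear (dmap f z)" using d1[OF that] by (rule has_derivative_linear)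
    have "dmap f z v = dmap f z (Re v *\<^sub>R 1 + Im v *\<^sub>R \<i>)"
      by (metis complex_eq mult.commute scaleR_conv_of_real mult.right_neutral)
    also have "\<dots> = Re v *\<^sub>R fx z + Im v *\<^sub>R fy z"
      by (simp add: linear_add[OF lin] linear_cmul[OF lin] fx_def fy_def)
    also have "\<dots> = p z * v + cnj (q z * v)"
      by (simp add: p_def q_def complex_eq_iff field_simps)
    finally show ?thesis .
  qed
  have "((\<lambda>z. f z - harmonic_sum h0 g z) has_derivative (\<lambda>v. 0)) (at z within ?B)" if z: "z \<in> ?B" for z
  proof (rule has_derivative_at_withinI)
    have hd: "(h0 has_derivative (*) (p z)) (at z)" "(g has_derivative (*) (q z)) (at z)"
      using h0[OF z] g[OF z] by (auto simp: has_field_derivative_def)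
    have "(harmonic_sum h0 g has_derivative (\<lambda>v. p z * v + cnj (q z * v))) (at z)"
      unfolding harmonic_sum_def[abs_def] by (intro derivative_intros hd)
    from has_derivative_diff[OF d1[OF z] this]
    show "((\<lambda>z. f z - harmonic_sum h0 g z) has_derivative (\<lambda>v. 0)) (at z)"
      by (simp add: df[OF z])
  qed
  from has_derivative_zero_constant[OF convex_ball this]
  obtain c where c: "\<And>z. z \<in> ?B \<Longrightarrow> f z - harmonic_sum h0 g z = c" by blast
  let ?h = "\<lambda>z. h0 z + c"
  have h: "(?h has_field_derivative p z) (at z)" if "z \<in> ?B" for z
    using h0[OF that] by (auto intro!: derivative_eq_intros)
  show thesis
  proof
    show "?h holomorphic_on ?B" "g holomorphic_on ?B"
      using h g by (meson field_differentiable_at_within field_differentiable_def holomorphic_on_def)+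
    show "f z = harmonic_sum ?h g z" if "z \<in> ?B" for z
      using c[OF that] by (simp add: harmonic_sum_def algebra_simps)
    show "dmap f 0 = (\<lambda>v. deriv ?h 0 * v + cnj (deriv g 0 * v))"
      using df[of 0] DERIV_imp_deriv[OF h[of 0]] DERIV_imp_deriv[OF g[of 0]] by (auto simp: fun_eq_iff)
  qed
qed

section \<open>Finiteness of the supremum \<open>M_dom\<close>\<close>

text \<open>Exponentiation turns a bound on the real part into one on the modulus, and Cauchy's
  estimate on the circle of radius 1/2 applies. The constant is crude; only its dependence on
  \<open>R\<close> alone matters.\<close>

lemma norm_deriv_le_of_Re_bounded:
  assumes H: "H holomorphic_on ball 0 1" and R: "\<And>z. z \<in> ball 0 1 \<Longrightarrow> \<bar>Re (H z)\<bar> \<le> R"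
  shows "norm (deriv H 0) \<le> 2 * exp (2 * R)"
proof -
  let ?E = "\<lambda>z. exp (H z)"
  have E: "?E holomorphic_on ball 0 1" using H by (intro holomorphic_intros)
  have "cball (0::complex) (1/2) \<subseteq> ball 0 1" by auto
  then have "?E holomorphic_on ball 0 (1/2)" "continuous_on (cball 0 (1/2)) ?E"
    using E by (auto intro: holomorphic_on_subset holomorphic_on_imp_continuous_on)
  moreover have "norm (?E x) \<le> exp R" if "norm (0 - x) = 1/2" for x
    using R[of x] that by (auto simp: abs_le_iff)
  ultimately have "norm ((deriv ^^ 1) ?E 0) \<le> fact 1 * exp R / (1/2)^1"
    by (intro Cauchy_inequality) auto
  moreover have "(H has_field_derivative deriv H 0) (at 0)"
    by (rule holomorphic_derivI[OF H]) auto
  then have "deriv ?E 0 = exp (H 0) * deriv H 0"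
    by (intro DERIV_imp_deriv DERIV_fun_exp)
  ultimately have "exp (Re (H 0)) * norm (deriv H 0) \<le> 2 * exp R"
    by (simp add: norm_mult)
  moreover have "exp (- R) \<le> exp (Re (H 0))"
    using R[of 0] by simp
  ultimately have "exp (- R) * norm (deriv H 0) \<le> 2 * exp R"
    by (meson mult_right_mono norm_ge_zero order_trans)
  then have "norm (deriv H 0) \<le> 2 * (exp R * exp R)"
    by (simp add: exp_minus divide_simps mult.assoc)
  also have "exp R * exp R = exp (2 * R)"
    by (simp flip: exp_add)
  finally show ?thesis .
qed

text \<open>The real part of \<open>f\<close> is that of \<open>h + g\<close>, and its imaginary
  part is minus the real part of \<open>\<i> * (h - g)\<close>. Both holomorphic functions thus have
  bounded real part, and their derivatives at 0 control \<open>deriv h 0\<close> and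
  \<open>deriv g 0\<close>.\<close>

lemma onorm_dmap_harmonic_le:
  assumes f: "harmonic_on f (ball 0 1)" and R: "\<And>z. z \<in> ball 0 1 \<Longrightarrow> norm (f z) \<le> R"
  shows "onorm (dmap f 0) \<le> 4 * exp (2 * R)"
proof -
  obtain h g where hg: "h holomorphic_on ball 0 1" "g holomorphic_on ball 0 1"
    and f_eq: "\<And>z. z \<in> ball 0 1 \<Longrightarrow> f z = harmonic_sum h g z"
    and df: "dmap f 0 = (\<lambda>v. deriv h 0 * v + cnj (deriv g 0 * v))"
    using harmonic_on_ball_decomposition[OF f] by metis
  have fd: "h field_differentiable at 0" "g field_differentiable at 0"
    using hg by (auto intro: holomorphic_on_imp_differentiable_at)
  have 1: "norm (deriv (\<lambda>z. h z + g z) 0) \<le> 2 * exp (2 * R)"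
  proof (rule norm_deriv_le_of_Re_bounded)
    show "\<bar>Re (h z + g z)\<bar> \<le> R" if "z \<in> ball 0 1" for z
      using R[OF that] abs_Re_le_cmod[of "f z"] f_eq[OF that] by (simp add: harmonic_sum_def)
  qed (use hg in \<open>auto intro!: holomorphic_intros\<close>)
  have 2: "norm (deriv (\<lambda>z. \<i> * (h z - g z)) 0) \<le> 2 * exp (2 * R)"
  proof (rule norm_deriv_le_of_Re_bounded)
    show "\<bar>Re (\<i> * (h z - g z))\<bar> \<le> R" if "z \<in> ball 0 1" for z
      using R[OF that] abs_Im_le_cmod[of "f z"] f_eq[OF that] by (simp add: harmonic_sum_def)
  qed (use hg in \<open>auto intro!: holomorphic_intros\<close>)
  have "deriv (\<lambda>z. h z + g z) 0 = deriv h 0 + deriv g 0"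
       "deriv (\<lambda>z. \<i> * (h z - g z)) 0 = \<i> * (deriv h 0 - deriv g 0)"
    using fd by (auto intro!: DERIV_imp_deriv derivative_eq_intros simp: DERIV_deriv_iff_field_differentiable)
  then have s: "norm (deriv h 0 + deriv g 0) \<le> 2 * exp (2 * R)" "norm (deriv h 0 - deriv g 0) \<le> 2 * exp (2 * R)"
    using 1 2 by (simp_all add: norm_mult)
  have "2 * norm (deriv h 0) \<le> norm (deriv h 0 + deriv g 0) + norm (deriv h 0 - deriv g 0)"
    using norm_triangle_ineq[of "deriv h 0 + deriv g 0" "deriv h 0 - deriv g 0"] by (simp add: norm_mult)
  moreover have "2 * norm (deriv g 0) \<le> norm (deriv h 0 + deriv g 0) + norm (deriv h 0 - deriv g 0)"
    using norm_triangle_ineq4[of "deriv h 0 + deriv g 0" "deriv h 0 - deriv g 0"] by (simp add: norm_mult)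
  ultimately have "norm (deriv h 0) + norm (deriv g 0) \<le> 4 * exp (2 * R)"
    using s by linarith
  moreover have "norm (dmap f 0 v) \<le> (norm (deriv h 0) + norm (deriv g 0)) * norm v" for v
    unfolding df using norm_triangle_ineq[of "deriv h 0 * v" "cnj (deriv g 0 * v)"]
    by (simp add: norm_mult distrib_right del: complex_cnj_mult)
  ultimately show ?thesis
    by (intro onorm_le) (meson mult_right_mono norm_ge_zero order_trans)
qed

lemma conformal_linear_mult: "conformal_linear (\<lambda>v. A * v)"
proof -
  \<comment> \<open>For \<open>A = 0\<close> the scale factor is 0, so any rotation will do.\<close>
  define u where "u = (if A = 0 then 1 else A / norm A)"
  have "orthogonal_transformation (\<lambda>v. u * v)"
    unfolding orthogonal_transformation by (auto simp: norm_mult u_def norm_divide intro: linear_compose_add linear_times)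
  moreover have "(\<lambda>v. A * v) = (\<lambda>v. norm A *\<^sub>R (u * v))"
    by (auto simp: u_def scaleR_conv_of_real)
  ultimately show ?thesis
    unfolding conformal_linear_def by (intro exI[of _ "norm A"] conjI exI[of _ "\<lambda>v. u * v"]) auto
qed

text \<open>A vanishing \<open>deriv g 0\<close> makes the differential at 0 a complex
  multiplication, hence conformal. Boundedness of \<open>D\<close> bounds the competing norms, so
  that \<open>Sup\<close> is a genuine upper bound.\<close>

lemma norm_deriv_le_M_dom:
  assumes "bounded D" and hg: "h holomorphic_on ball 0 1" "g holomorphic_on ball 0 1"
    and sub: "harmonic_sum h g ` ball 0 1 \<subseteq> D" and p: "harmonic_sum h g 0 = p" and g0: "deriv g 0 = 0"
  shows "norm (deriv h 0) \<le> M_dom D p"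
proof -
  obtain R where R: "\<And>x. x \<in> D \<Longrightarrow> norm x \<le> R"
    using \<open>bounded D\<close> by (auto simp: bounded_iff)
  let ?X = "{onorm (dmap f 0) | f. harmonic_on f (ball 0 1) \<and> f ` ball 0 1 \<subseteq> D
                      \<and> f 0 = p \<and> conformal_linear (dmap f 0)}"
  have "bdd_above ?X"
    using onorm_dmap_harmonic_le R by (intro bdd_aboveI[of _ "4 * exp (2 * R)"]) blast
  have df: "dmap (harmonic_sum h g) 0 = (\<lambda>v. deriv h 0 * v)"
    using dmap_harmonic_sum[OF hg open_ball, of 0] g0 by simp
  have "onorm (dmap (harmonic_sum h g) 0) \<in> ?X"
    using harmonic_on_harmonic_sum[OF hg open_ball] sub p df conformal_linear_mult[of "deriv h 0"]
    by (intro CollectI exI[of _ "harmonic_sum h g"]) simp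
  then have "onorm (\<lambda>v. deriv h 0 * v) \<le> M_dom D p"
    unfolding M_dom_def df[symmetric] using \<open>bdd_above ?X\<close> by (rule cSup_upper)
  moreover have "norm (deriv h 0) \<le> onorm (\<lambda>v. deriv h 0 * v)"
    using onorm[OF bounded_linear_mult_right, of "deriv h 0" 1] by simp
  ultimately show ?thesis by linarith
qed

section \<open>Lagrange multipliers\<close>

text \<open>The triples of Fourier coefficients of harmonic maps into the domain form a convex set, which is
  separated from the ray of values that would beat the extremal one; since the domain contains a
  neighbourhood of 0, the multiplier of \<open>a\<^sub>1\<close> cannot vanish.\<close>

lemma extremal_multipliers:
  assumes D: "open D" "convex D" "bounded D" "0 \<in> D" and A: "norm A = M_dom D 0" "A \<noteq> 0"
  obtains \<gamma>0 \<gamma>1 \<gamma>2 where "Re (\<gamma>1 * A) > 0"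
    "\<And>h g. h holomorphic_on ball 0 1 \<Longrightarrow> g holomorphic_on ball 0 1 \<Longrightarrow> harmonic_sum h g ` ball 0 1 \<subseteq> D \<Longrightarrow>
       Re (\<gamma>0 * harmonic_sum h g 0 + \<gamma>1 * deriv h 0 + \<gamma>2 * cnj (deriv g 0)) \<le> Re (\<gamma>1 * A)"
proof -
  let ?B = "ball (0::complex) 1"
  define adm where "adm h g \<longleftrightarrow> h holomorphic_on ?B \<and> g holomorphic_on ?B \<and> harmonic_sum h g ` ?B \<subseteq> D" for h g
  define K where "K = {(harmonic_sum h g 0, deriv h 0, cnj (deriv g 0)) | h g. adm h g}"
  define T where "T = {(0::complex, of_real t * A, 0::complex) | t. t > 1}"
  have adm_diff: "(h has_field_derivative deriv h 0) (at 0)" "(g has_field_derivative deriv g 0) (at 0)"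
    if "adm h g" for h g
    using that by (auto simp: adm_def intro!: holomorphic_derivI[of _ ?B])
  have "convex K"
  proof (rule convexI)
    fix x y :: "complex \<times> complex \<times> complex" and a b :: real
    assume xy: "x \<in> K" "y \<in> K" and ab: "0 \<le> a" "0 \<le> b" "a + b = 1"
    obtain h1 g1 h2 g2 where adm: "adm h1 g1" "adm h2 g2"
      and x: "x = (harmonic_sum h1 g1 0, deriv h1 0, cnj (deriv g1 0))"
      and y: "y = (harmonic_sum h2 g2 0, deriv h2 0, cnj (deriv g2 0))"
      using xy unfolding K_def by blast
    let ?h = "\<lambda>z. of_real a * h1 z + of_real b * h2 z" and ?g = "\<lambda>z. of_real a * g1 z + of_real b * g2 z"
    have hs: "harmonic_sum ?h ?g z = a *\<^sub>R harmonic_sum h1 g1 z + b *\<^sub>R harmonic_sum h2 g2 z" for z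
      by (simp add: harmonic_sum_def scaleR_conv_of_real algebra_simps)
    have "adm ?h ?g"
      unfolding adm_def
    proof (intro conjI)
      show "harmonic_sum ?h ?g ` ?B \<subseteq> D"
        using adm ab \<open>convex D\<close> unfolding adm_def image_subset_iff hs by (auto intro!: convexD)
    qed (use adm in \<open>auto simp: adm_def intro!: holomorphic_intros\<close>)
    moreover have "deriv ?h 0 = of_real a * deriv h1 0 + of_real b * deriv h2 0"
      "deriv ?g 0 = of_real a * deriv g1 0 + of_real b * deriv g2 0"
      using adm_diff[OF adm(1)] adm_diff[OF adm(2)]
      by (auto intro!: DERIV_imp_deriv DERIV_add DERIV_cmult)
    ultimately show "a *\<^sub>R x + b *\<^sub>R y \<in> K"
      unfolding K_def x y
      by (intro CollectI exI[of _ ?h] exI[of _ ?g]) (simp add: hs scaleR_conv_of_real)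
  qed
  have "convex T"
  proof (rule convexI)
    fix x y :: "complex \<times> complex \<times> complex" and a b :: real
    assume xy: "x \<in> T" "y \<in> T" and ab: "0 \<le> a" "0 \<le> b" "a + b = 1"
    obtain s t where st: "s > 1" "t > 1" and x: "x = (0, of_real s * A, 0)" and y: "y = (0, of_real t * A, 0)"
      using xy unfolding T_def by blast
    have "a * s + b * t > 1"
      using convexD[of "{1<..}" s t a b] st ab by (auto simp: convex_real_interval)
    then show "a *\<^sub>R x + b *\<^sub>R y \<in> T"
      unfolding T_def x y
      by (intro CollectI exI[of _ "a * s + b * t"]) (simp add: scaleR_conv_of_real algebra_simps)
  qed
  \<comment> \<open>A common point would be a conformal competitor fixing 0 whose derivative at 0
    has norm above \<open>M_dom D 0\<close>.\<close>
  have "K \<inter> T = {}"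
  proof (rule ccontr)
    assume "K \<inter> T \<noteq> {}"
    then obtain x where "x \<in> K" "x \<in> T" by blast
    from \<open>x \<in> K\<close> obtain h g where adm: "adm h g"
      and x: "x = (harmonic_sum h g 0, deriv h 0, cnj (deriv g 0))"
      unfolding K_def by blast
    from \<open>x \<in> T\<close> obtain t where t: "t > 1"
      and eq: "harmonic_sum h g 0 = 0" "deriv h 0 = of_real t * A" "cnj (deriv g 0) = 0"
      unfolding T_def x by blast
    have "norm (deriv h 0) \<le> norm A"
      using norm_deriv_le_M_dom[OF \<open>bounded D\<close>, of h g 0] adm eq A by (simp add: adm_def)
    then show False
      using t A(2) by (simp add: eq norm_mult)
  qed
  have "adm (\<lambda>_. 0) (\<lambda>_. 0)"
    using \<open>0 \<in> D\<close> by (auto simp: adm_def harmonic_sum_def)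
  then have "K \<noteq> {}" unfolding K_def by blast
  moreover have "T \<noteq> {}" unfolding T_def using gt_ex[of "1::real"] by blast
  ultimately obtain \<alpha> b where "\<alpha> \<noteq> 0" and K_le: "\<And>x. x \<in> K \<Longrightarrow> \<alpha> \<bullet> x \<le> b" and T_ge: "\<And>x. x \<in> T \<Longrightarrow> \<alpha> \<bullet> x \<ge> b"
    using separating_hyperplane_sets[OF \<open>convex K\<close> \<open>convex T\<close> _ _ \<open>K \<inter> T = {}\<close>] by blast
  obtain a0 a1 a2 where \<alpha>: "\<alpha> = (a0, a1, a2)" by (cases \<alpha>)
  \<comment> \<open>Conjugation turns the real inner product into the real part of a complex
    bilinear expression.\<close>
  define \<gamma>0 \<gamma>1 \<gamma>2 where \<gamma>: "\<gamma>0 = cnj a0" "\<gamma>1 = cnj a1" "\<gamma>2 = cnj a2"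
  have inner: "\<alpha> \<bullet> (x, y, z) = Re (\<gamma>0 * x + \<gamma>1 * y + \<gamma>2 * z)" for x y z
    by (simp add: \<alpha> \<gamma> inner_complex_def)
  have le: "Re (\<gamma>0 * harmonic_sum h g 0 + \<gamma>1 * deriv h 0 + \<gamma>2 * cnj (deriv g 0)) \<le> b" if "adm h g" for h g
    using K_le[of "(harmonic_sum h g 0, deriv h 0, cnj (deriv g 0))"] that inner unfolding K_def by auto
  have ge: "b \<le> t * Re (\<gamma>1 * A)" if "t > 1" for t
  proof -
    have "(0, of_real t * A, 0) \<in> T" using that unfolding T_def by blast
    from T_ge[OF this] show ?thesis
      by (simp add: inner algebra_simps)
  qed
  have b_le: "b \<le> Re (\<gamma>1 * A)"
  proof (rule tendsto_lowerbound)
    show "((\<lambda>t. t * Re (\<gamma>1 * A)) \<longlongrightarrow> Re (\<gamma>1 * A)) (at_right 1)"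
      by (auto intro!: tendsto_eq_intros)
    show "\<forall>\<^sub>F t in at_right 1. b \<le> t * Re (\<gamma>1 * A)"
      using ge by (auto simp: eventually_at_right_field intro: exI[of _ 2])
  qed simp
  \<comment> \<open>Test the functional on the map with coefficients \<open>cnj \<gamma>0\<close>,
    \<open>cnj \<gamma>1\<close>, \<open>cnj \<gamma>2\<close>, scaled by \<open>\<epsilon>\<close>
    to fit into a ball around 0 in \<open>D\<close>: its value is \<open>\<epsilon>\<close> times
    the sum of their squared moduli.\<close>
  have "b > 0"
  proof -
    obtain \<delta> where \<delta>: "\<delta> > 0" "ball 0 \<delta> \<subseteq> D" using D by (auto elim: openE)
    define N where "N = norm \<gamma>0 + norm \<gamma>1 + norm \<gamma>2"
    have "N > 0"
      using \<open>\<alpha> \<noteq> 0\<close> unfolding N_def \<alpha> \<gamma>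
      by (smt (verit, best) complex_mod_cnj norm_ge_zero zero_less_norm_iff zero_prod_def)
    define \<epsilon> where "\<epsilon> = \<delta> / (2 * N)"
    have "\<epsilon> > 0" using \<delta> \<open>N > 0\<close> by (simp add: \<epsilon>_def)
    let ?h = "\<lambda>z. of_real \<epsilon> * (cnj \<gamma>0 + cnj \<gamma>1 * z)" and ?g = "\<lambda>z. of_real \<epsilon> * \<gamma>2 * z"
    have "harmonic_sum ?h ?g z \<in> D" if z: "z \<in> ?B" for z
    proof -
      have "harmonic_sum ?h ?g z = of_real \<epsilon> * (cnj \<gamma>0 + cnj \<gamma>1 * z + cnj \<gamma>2 * cnj z)"
        by (simp add: harmonic_sum_def algebra_simps)
      then have "norm (harmonic_sum ?h ?g z) = \<epsilon> * norm (cnj \<gamma>0 + cnj \<gamma>1 * z + cnj \<gamma>2 * cnj z)"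
        using \<open>\<epsilon> > 0\<close> by (simp only: norm_mult norm_of_real abs_of_pos)
      also have "\<dots> \<le> \<epsilon> * (norm \<gamma>0 + norm \<gamma>1 * norm z + norm \<gamma>2 * norm z)"
        using \<open>\<epsilon> > 0\<close> by (intro mult_left_mono norm_triangle_mono) (auto simp: norm_mult)
      also have "\<dots> \<le> \<epsilon> * (norm \<gamma>0 + norm \<gamma>1 * 1 + norm \<gamma>2 * 1)"
        using z \<open>\<epsilon> > 0\<close> by (intro mult_left_mono add_mono) auto
      also have "\<dots> = \<delta> / 2" using \<open>N > 0\<close> by (simp add: \<epsilon>_def flip: N_def)
      also have "\<dots> < \<delta>" using \<delta> by simp
      finally show ?thesis using \<delta> by (auto simp: subset_iff)
    qed
    then have "adm ?h ?g" by (auto simp: adm_def intro!: holomorphic_intros)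
    moreover have "deriv ?h 0 = of_real \<epsilon> * cnj \<gamma>1" "deriv ?g 0 = of_real \<epsilon> * \<gamma>2"
      by (auto intro!: DERIV_imp_deriv derivative_eq_intros)
    ultimately have "Re (\<gamma>0 * (of_real \<epsilon> * cnj \<gamma>0) + \<gamma>1 * (of_real \<epsilon> * cnj \<gamma>1) + \<gamma>2 * (of_real \<epsilon> * cnj \<gamma>2)) \<le> b"
      using le[of ?h ?g] by (simp add: harmonic_sum_def)
    then have "\<epsilon> * ((norm \<gamma>0)\<^sup>2 + (norm \<gamma>1)\<^sup>2 + (norm \<gamma>2)\<^sup>2) \<le> b"
      unfolding cmod_power2 by (simp add: power2_eq_square algebra_simps)
    moreover have "(norm \<gamma>0)\<^sup>2 + (norm \<gamma>1)\<^sup>2 + (norm \<gamma>2)\<^sup>2 > 0"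
      using \<open>N > 0\<close> unfolding N_def
      by (smt (verit) norm_ge_zero zero_le_power2 zero_less_power2)
    ultimately show ?thesis
      using \<open>\<epsilon> > 0\<close> by (meson less_le_trans mult_pos_pos)
  qed
  show thesis
  proof
    show "Re (\<gamma>1 * A) > 0" using \<open>b > 0\<close> b_le by linarith
    show "Re (\<gamma>0 * harmonic_sum h g 0 + \<gamma>1 * deriv h 0 + \<gamma>2 * cnj (deriv g 0)) \<le> Re (\<gamma>1 * A)"
      if "h holomorphic_on ?B" "g holomorphic_on ?B" "harmonic_sum h g ` ?B \<subseteq> D" for h g
      using le[of h g] that b_le by (simp add: adm_def)
  qed
qed

section \<open>Variation of the boundary values\<close>

text \<open>Maximum modulus principle for \<open>exp (H z)\<close>. As \<open>H\<close> need not
  extend to the unit circle, its boundary bound is stated as a bound up to \<open>\<epsilon>\<close>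
  on a thin annulus.\<close>

lemma Re_holomorphic_le_boundary:
  assumes H: "H holomorphic_on ball 0 1"
    and bd: "\<And>\<epsilon>. \<epsilon> > 0 \<Longrightarrow> \<exists>r<1. \<forall>z. r \<le> norm z \<and> norm z < 1 \<longrightarrow> Re (H z) \<le> B + \<epsilon>"
    and z: "z \<in> ball 0 1"
  shows "Re (H z) \<le> B"
proof (rule field_le_epsilon)
  fix \<epsilon> :: real assume "\<epsilon> > 0"
  from bd[OF this] obtain r where r: "r < 1" "\<And>z. r \<le> norm z \<Longrightarrow> norm z < 1 \<Longrightarrow> Re (H z) \<le> B + \<epsilon>"
    by blast
  define \<rho> where "\<rho> = max r ((1 + norm z) / 2)"
  have \<rho>: "r \<le> \<rho>" "norm z < \<rho>" "\<rho> < 1" "0 < \<rho>"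
    using z r norm_ge_zero[of z] by (auto simp: \<rho>_def less_max_iff_disj simp del: norm_ge_zero)
  have sub: "cball (0::complex) \<rho> \<subseteq> ball 0 1" using \<rho> by auto
  have "norm (exp (H z)) \<le> exp (B + \<epsilon>)"
  proof (rule maximum_modulus_frontier[where S="cball 0 \<rho>" and f="\<lambda>w. exp (H w)"])
    have "(\<lambda>w. exp (H w)) holomorphic_on cball 0 \<rho>"
      using H sub by (auto intro!: holomorphic_intros intro: holomorphic_on_subset)
    then show "(\<lambda>w. exp (H w)) holomorphic_on interior (cball 0 \<rho>)"
      "continuous_on (closure (cball 0 \<rho>)) (\<lambda>w. exp (H w))"
      by (auto intro: holomorphic_on_subset holomorphic_on_imp_continuous_on simp: interior_subset)
    show "norm (exp (H w)) \<le> exp (B + \<epsilon>)" if "w \<in> frontier (cball 0 \<rho>)" for w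
      using that \<rho> r(2)[of w] by simp
  qed (use \<rho> in auto)
  then show "Re (H z) \<le> B + \<epsilon>" by simp
qed

text \<open>A closed convex set is an intersection of half-planes, and for each \<open>a\<close> the
  inner product of \<open>a\<close> with \<open>h + cnj g\<close> is the real part of the
  holomorphic function \<open>cnj a * h + a * g\<close>. This reduces the claim to the preceding
  maximum principle.\<close>

lemma harmonic_sum_in_closed_convex:
  assumes hg: "h holomorphic_on ball 0 1" "g holomorphic_on ball 0 1"
    and C: "closed C" "convex C"
    and bd: "\<And>\<epsilon>. \<epsilon> > 0 \<Longrightarrow> \<exists>r<1. \<forall>z. r \<le> norm z \<and> norm z < 1 \<longrightarrow> (\<exists>y\<in>C. norm (harmonic_sum h g z - y) \<le> \<epsilon>)"
    and z: "z \<in> ball 0 1"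
  shows "harmonic_sum h g z \<in> C"
proof (rule ccontr)
  assume "harmonic_sum h g z \<notin> C"
  then obtain a b where less: "a \<bullet> harmonic_sum h g z < b" and gt: "\<And>y. y \<in> C \<Longrightarrow> a \<bullet> y > b"
    using separating_hyperplane_closed_point[OF C(2,1)] by blast
  define H where "H = (\<lambda>w. - (cnj a * h w + a * g w))"
  have Re_H: "Re (H w) = - (a \<bullet> harmonic_sum h g w)" for w
    by (simp add: H_def harmonic_sum_def inner_complex_def algebra_simps)
  have "Re (H z) \<le> - b"
  proof (rule Re_holomorphic_le_boundary[OF _ _ z])
    show "H holomorphic_on ball 0 1"
      unfolding H_def using hg by (intro holomorphic_intros)
    fix \<epsilon> :: real assume "\<epsilon> > 0"
    define \<delta> where "\<delta> = \<epsilon> / (norm a + 1)"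
    have na: "norm a + 1 > 0" using norm_ge_zero[of a] by linarith
    have "\<delta> > 0" using \<open>\<epsilon> > 0\<close> na by (simp add: \<delta>_def)
    from bd[OF this] obtain r where r: "r < 1"
      "\<And>w. r \<le> norm w \<Longrightarrow> norm w < 1 \<Longrightarrow> \<exists>y\<in>C. norm (harmonic_sum h g w - y) \<le> \<delta>" by blast
    have "Re (H w) \<le> - b + \<epsilon>" if w: "r \<le> norm w" "norm w < 1" for w
    proof -
      obtain y where y: "y \<in> C" "norm (harmonic_sum h g w - y) \<le> \<delta>" using r(2)[OF w] by blast
      have "\<bar>a \<bullet> (harmonic_sum h g w - y)\<bar> \<le> norm a * norm (harmonic_sum h g w - y)"
        by (rule Cauchy_Schwarz_ineq2)
      also have "\<dots> \<le> (norm a + 1) * \<delta>"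
        using y by (intro mult_mono) auto
      also have "\<dots> = \<epsilon>" using na by (simp add: \<delta>_def)
      finally show ?thesis
        using gt[OF y(1)] unfolding Re_H inner_diff_right by linarith
    qed
    then show "\<exists>r<1. \<forall>w. r \<le> norm w \<and> norm w < 1 \<longrightarrow> Re (H w) \<le> - b + \<epsilon>"
      using r(1) by blast
  qed
  then show False using less by (simp add: Re_H)
qed

text \<open>\<open>Q\<close> is the tail of the series divided by \<open>z ^ n\<close>; defining it
  by its own series makes it holomorphic at 0 as well.\<close>

lemma power_series_remainder:
  fixes c :: "nat \<Rightarrow> complex"
  assumes G: "\<And>z. z \<in> ball 0 1 \<Longrightarrow> (\<lambda>k. c k * z ^ k) sums G z"
  obtains Q where "Q holomorphic_on ball 0 1"
    "\<And>z. z \<in> ball 0 1 \<Longrightarrow> G z = (\<Sum>k<n. c k * z ^ k) + z ^ n * Q z"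
    "Q 0 = c n" "deriv Q 0 = c (Suc n)"
proof -
  define Q where "Q = (\<lambda>n z. \<Sum>k. c (k + n) * z ^ k)"
  have sums: "(\<lambda>k. c (k + n) * z ^ k) sums Q n z" if z: "z \<in> ball 0 1" for n z
  proof (cases "z = 0")
    case True
    then show ?thesis
      unfolding Q_def using powser_sums_zero[of "\<lambda>k. c (k + n)"] by (simp add: sums_iff)
  next
    case False
    have "summable (\<lambda>k. c (k + n) * z ^ (k + n))"
      using summable_iff_shift[of "\<lambda>k. c k * z ^ k" n] G[OF z] by (simp add: sums_iff)
    then have "summable (\<lambda>k. inverse (z ^ n) * (c (k + n) * z ^ (k + n)))"
      by (rule summable_mult)
    then show ?thesis
      unfolding Q_def using False by (simp add: power_add summable_sums field_simps)
  qed
  have hol: "Q n holomorphic_on ball 0 1" for n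
    by (rule power_series_holomorphic[where a="\<lambda>k. c (k + n)"]) (use sums[of _ n] in simp)
  have Q0: "Q n 0 = c n" for n
    unfolding Q_def using powser_sums_zero[of "\<lambda>k. c (k + n)"] by (simp add: sums_iff)
  \<comment> \<open>All the tails are treated at once, because the derivative of \<open>Q n\<close>
    at 0 is read off from the value of the next tail.\<close>
  have Q_Suc: "Q n z = c n + z * Q (Suc n) z" if z: "z \<in> ball 0 1" for n z
  proof -
    have "(\<lambda>k. z * (c (k + Suc n) * z ^ k)) sums (z * Q (Suc n) z)"
      using sums[OF z] by (rule sums_mult)
    then have "(\<lambda>k. c (Suc k + n) * z ^ Suc k) sums (z * Q (Suc n) z)"
      by (simp add: mult.left_commute)
    then have "(\<lambda>k. c (k + n) * z ^ k) sums (z * Q (Suc n) z + c n)"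
      by (subst (asm) sums_Suc_iff) simp
    with sums[OF z, of n] show ?thesis using sums_unique2 by fastforce
  qed
  have dQ: "deriv (Q n) 0 = c (Suc n)" for n
  proof (rule DERIV_imp_deriv)
    have "(Q (Suc n) has_field_derivative deriv (Q (Suc n)) 0) (at 0)"
      by (rule holomorphic_derivI[OF hol]) auto
    then have "((\<lambda>z. c n + z * Q (Suc n) z) has_field_derivative c (Suc n)) (at 0)"
      by (auto intro!: derivative_eq_intros simp: Q0)
    then show "(Q n has_field_derivative c (Suc n)) (at 0)"
      by (rule has_field_derivative_transform_within_open[where S="ball 0 1"]) (auto simp: Q_Suc[of _ n])
  qed
  have exp: "G z = (\<Sum>k<n. c k * z ^ k) + z ^ n * Q n z" if z: "z \<in> ball 0 1" for n z
  proof (induction n)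
    case 0
    show ?case using G[OF z] sums[OF z, of 0] sums_unique2 by fastforce
  next
    case (Suc n)
    then show ?case by (simp add: Q_Suc[OF z, of n] algebra_simps)
  qed
  show thesis using that[of "Q n"] hol exp Q0 dQ by blast
qed

lemma power_series_at_0:
  fixes c :: "nat \<Rightarrow> complex"
  assumes "\<And>z. z \<in> ball 0 1 \<Longrightarrow> (\<lambda>k. c k * z ^ k) sums G z"
  shows "G 0 = c 0" "(G has_field_derivative c 1) (at 0)"
proof -
  obtain Q where Q: "Q holomorphic_on ball 0 1"
    "\<And>z. z \<in> ball 0 1 \<Longrightarrow> G z = (\<Sum>k<0. c k * z ^ k) + z ^ 0 * Q z" "Q 0 = c 0" "deriv Q 0 = c (Suc 0)"
    using power_series_remainder[OF assms, where n=0] by blast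
  then show "G 0 = c 0" by simp
  have "(Q has_field_derivative c 1) (at 0)"
    using holomorphic_derivI[OF Q(1), of 0] Q(4) by simp
  then show "(G has_field_derivative c 1) (at 0)"
    by (rule has_field_derivative_transform_within_open[where S="ball 0 1"]) (auto simp: Q(2))
qed

text \<open>On the unit circle, replacing \<open>\<Phi>(z)\<close> by \<open>\<Phi>(e\<^sup>i\<^sup>s z)\<close> with probability
  \<open>\<mu>(z) = (1 + Re (\<kappa> z\<^sup>n)) / 2\<close>, where \<open>n = m + 1\<close>, keeps the values in the convex set.
  The map constructed here is the harmonic extension of these boundary values; the term
  \<open>cnj z ^ n * (\<Phi>(e\<^sup>i\<^sup>s z) - \<Phi> z)\<close> is extended by splitting the power series at degree \<open>n\<close>.\<close>

lemma randomly_rotated_competitor: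
  fixes A :: "nat \<Rightarrow> complex" and s :: real and \<kappa> :: complex and m :: nat
  defines "e \<equiv> \<lambda>k. A k * (cis s ^ k - 1)"
  assumes ser: "\<And>z. z \<in> ball 0 1 \<Longrightarrow> (\<lambda>k. A k * z ^ k) sums \<Phi> z"
    and sub: "\<Phi> ` ball 0 1 \<subseteq> D" and D: "convex D" "bounded D" and \<kappa>: "norm \<kappa> \<le> 1"
  obtains h g where "h holomorphic_on ball 0 1" "g holomorphic_on ball 0 1"
    "harmonic_sum h g ` ball 0 1 \<subseteq> closure D"
    "harmonic_sum h g 0 = A 0 + cnj \<kappa> / 4 * e (Suc m)"
    "deriv h 0 = A 1 + e 1 / 2 + cnj \<kappa> / 4 * e (Suc (Suc m))"
    "cnj (deriv g 0) = cnj \<kappa> / 4 * e m"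
proof -
  let ?B = "ball (0::complex) 1" and ?n = "Suc m"
  define G where "G = (\<lambda>z. \<Phi> (cis s * z) - \<Phi> z)"
  have rot: "cis s * z \<in> ?B" if "z \<in> ?B" for z using that by (simp add: norm_mult)
  have G_sums: "(\<lambda>k. e k * z ^ k) sums G z" if "z \<in> ?B" for z
    using sums_diff[OF ser[OF rot[OF that]] ser[OF that]]
    by (simp add: G_def e_def power_mult_distrib algebra_simps)
  obtain Q where Q: "Q holomorphic_on ?B" "\<And>z. z \<in> ?B \<Longrightarrow> G z = (\<Sum>k<?n. e k * z ^ k) + z ^ ?n * Q z"
    "Q 0 = e ?n" "deriv Q 0 = e (Suc ?n)"
    using power_series_remainder[OF G_sums, where n="?n"] by metis
  \<comment> \<open>On the unit circle \<open>cnj z ^ n * G z\<close> equals \<open>Q z\<close> plus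
    the sum of \<open>e k * cnj z ^ (n - k)\<close> over \<open>k < n\<close>. The first term is
    holomorphic and goes into \<open>h\<close>; the second is antiholomorphic and goes into
    \<open>g\<close>.\<close>
  define h where "h = (\<lambda>z. \<Phi> z + G z / 2 + \<kappa> / 4 * z ^ ?n * G z + cnj \<kappa> / 4 * Q z)"
  define g where "g = (\<lambda>z. \<kappa> / 4 * (\<Sum>k<?n. cnj (e k) * z ^ (?n - k)))"
  have "\<Phi> holomorphic_on ?B" "G holomorphic_on ?B"
    using ser G_sums power_series_holomorphic[of 0 1] by auto
  then have h: "h holomorphic_on ?B"
    unfolding h_def using Q by (intro holomorphic_intros) auto
  have g: "g holomorphic_on ?B"
    unfolding g_def by (intro holomorphic_intros)
  have e0: "e 0 = 0" by (simp add: e_def)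
  have at0: "\<Phi> 0 = A 0" "(\<Phi> has_field_derivative A 1) (at 0)" "G 0 = 0" "(G has_field_derivative e 1) (at 0)"
    using power_series_at_0[OF ser] power_series_at_0[OF G_sums] e0 by auto
  have dQ: "(Q has_field_derivative e (Suc ?n)) (at 0)"
    using holomorphic_derivI[OF Q(1), of 0] Q(4) by simp
  have dh: "deriv h 0 = A 1 + e 1 / 2 + cnj \<kappa> / 4 * e (Suc ?n)"
    unfolding h_def by (rule DERIV_imp_deriv) (auto intro!: derivative_eq_intros at0 dQ simp: at0)
  \<comment> \<open>For \<open>k < m\<close> the exponent is at least 2, so only
    \<open>k = m\<close> contributes to the derivative of \<open>g\<close> at 0.\<close>
  have "((\<lambda>z. \<Sum>k<m. cnj (e k) * z ^ (?n - k)) has_field_derivative (\<Sum>k<m. 0)) (at 0)"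
    by (intro DERIV_sum) (auto intro!: derivative_eq_intros simp: power_0_left)
  then have "((\<lambda>z. \<kappa> / 4 * ((\<Sum>k<m. cnj (e k) * z ^ (?n - k)) + cnj (e m) * z)) has_field_derivative
      \<kappa> / 4 * ((\<Sum>k<m. 0) + cnj (e m) * 1)) (at 0)"
    by (intro DERIV_cmult DERIV_add DERIV_ident)
  then have "(g has_field_derivative \<kappa> / 4 * cnj (e m)) (at 0)"
    by (simp add: g_def)
  then have dg: "cnj (deriv g 0) = cnj \<kappa> / 4 * e m"
    by (simp add: DERIV_imp_deriv)
  have "g 0 = 0"
    by (auto simp: g_def power_0_left simp del: sum.lessThan_Suc intro!: sum.neutral)
  then have h0: "harmonic_sum h g 0 = A 0 + cnj \<kappa> / 4 * e ?n"
    by (simp add: harmonic_sum_def h_def at0 Q)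
  obtain R where R: "\<And>x. x \<in> D \<Longrightarrow> norm x \<le> R"
    using \<open>bounded D\<close> by (auto simp: bounded_iff)
  \<comment> \<open>\<open>Q\<close> is estimated only for \<open>1/2 \<le> norm z\<close>, where
    dividing by \<open>z ^ n\<close> costs at most the factor \<open>2 ^ n\<close>.\<close>
  define \<Sigma> where "\<Sigma> = (\<Sum>k<?n. norm (e k))"
  define M where "M = 2 ^ ?n * (2 * R + \<Sigma>)"
  have Q_le: "norm (Q z) \<le> M" if z: "z \<in> ?B" "1/2 \<le> norm z" for z
  proof -
    have "z ^ ?n * Q z = G z - (\<Sum>k<?n. e k * z ^ k)" using Q(2)[OF z(1)] by simp
    also have "norm \<dots> \<le> 2 * R + \<Sigma>"
    proof (rule order_trans[OF norm_triangle_ineq4] , rule add_mono)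
      have "norm (\<Phi> (cis s * z)) \<le> R" "norm (\<Phi> z) \<le> R"
        using sub rot[OF z(1)] z(1) by (blast intro: R)+
      then show "norm (G z) \<le> 2 * R"
        unfolding G_def using norm_triangle_ineq4[of "\<Phi> (cis s * z)" "\<Phi> z"] by linarith
      show "norm (\<Sum>k<?n. e k * z ^ k) \<le> \<Sigma>"
        unfolding \<Sigma>_def using z
        by (intro sum_norm_le) (auto simp: norm_mult norm_power intro!: mult_left_le power_le_one)
    qed
    finally have *: "norm z ^ ?n * norm (Q z) \<le> 2 * R + \<Sigma>" by (simp add: norm_mult norm_power)
    have "(1/2) ^ ?n * norm (Q z) \<le> norm z ^ ?n * norm (Q z)"
      using z by (intro mult_right_mono power_mono) auto
    with * have "(1/2) ^ ?n * norm (Q z) \<le> 2 * R + \<Sigma>" by linarith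
    then show ?thesis unfolding M_def by (simp add: field_simps power_divide)
  qed
  \<comment> \<open>\<open>E \<rho>\<close> bounds, on the circle of radius \<open>\<rho>\<close>
    near 1, the distance from the harmonic map to the convex combination \<open>y\<close> below.
    Each term carries a factor \<open>1 - \<rho>\<^sup>2 ^ k\<close>, so it tends to 0 as
    \<open>\<rho>\<close> tends to 1.\<close>
  define E where "E = (\<lambda>\<rho>::real. (1 - (\<rho>\<^sup>2) ^ ?n) * M + (\<Sum>k<?n. norm (e k) * (1 - (\<rho>\<^sup>2) ^ k)))"
  have "harmonic_sum h g z \<in> closure D" if "z \<in> ?B" for z
  proof (rule harmonic_sum_in_closed_convex[OF h g _ _ _ that])
    show "convex (closure D)" using D by (simp add: convex_closure)
    fix \<epsilon> :: real assume "\<epsilon> > 0"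
    have "(E \<longlongrightarrow> 0) (at_left 1)"
      unfolding E_def by (rule tendsto_eq_intros refl | simp)+
    then have "\<forall>\<^sub>F \<rho> in at_left 1. E \<rho> < \<epsilon>"
      using \<open>\<epsilon> > 0\<close> by (rule order_tendstoD)
    then obtain r0 where r0: "r0 < 1" "\<And>\<rho>. r0 < \<rho> \<Longrightarrow> \<rho> < 1 \<Longrightarrow> E \<rho> < \<epsilon>"
      by (auto simp: eventually_at_left_field)
    define r where "r = max (1/2) ((1 + r0) / 2)"
    have r: "r < 1" "1/2 \<le> r" "r0 < r" using r0 by (auto simp: r_def less_max_iff_disj)
    have "\<exists>y\<in>closure D. norm (harmonic_sum h g z - y) \<le> \<epsilon>" if z: "r \<le> norm z" "norm z < 1" for z
    proof -
      have zB: "z \<in> ?B" using z by simp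
      define \<mu> where "\<mu> = (1 + Re (\<kappa> * z ^ ?n)) / 2"
      have "\<bar>Re (\<kappa> * z ^ ?n)\<bar> \<le> norm (\<kappa> * z ^ ?n)" by (rule abs_Re_le_cmod)
      also have "\<dots> \<le> 1 * 1"
        unfolding norm_mult norm_power using \<kappa> z by (intro mult_mono power_le_one) auto
      finally have \<mu>: "0 \<le> \<mu>" "\<mu> \<le> 1" by (auto simp: \<mu>_def abs_le_iff)
      define y where "y = (1 - \<mu>) *\<^sub>R \<Phi> z + \<mu> *\<^sub>R \<Phi> (cis s * z)"
      have "y \<in> D"
        unfolding y_def using \<mu> sub rot[OF zB] zB D(1) by (intro convexD) auto
      have \<mu>_eq: "of_real \<mu> = (1 + (\<kappa> * z ^ ?n + cnj \<kappa> * cnj z ^ ?n) / 2) / 2"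
        by (simp add: \<mu>_def complex_eq_iff del: power_Suc flip: complex_cnj_power complex_cnj_mult)
      have y_eq: "y = \<Phi> z + (1 + (\<kappa> * z ^ ?n + cnj \<kappa> * cnj z ^ ?n) / 2) / 2 * G z"
        unfolding \<mu>_eq[symmetric] by (simp add: y_def G_def scaleR_conv_of_real algebra_simps)
      have zz: "cnj z * z = of_real ((norm z)\<^sup>2)"
        by (simp only: complex_norm_square mult.commute)
      have "cnj z ^ ?n * G z = (cnj z * z) ^ ?n * Q z + (\<Sum>k<?n. e k * (cnj z ^ ?n * z ^ k))"
        unfolding Q(2)[OF zB] by (simp add: distrib_left sum_distrib_left power_mult_distrib mult_ac del: power_Suc)
      moreover have "harmonic_sum h g z - y
         = cnj \<kappa> / 4 * (Q z + (\<Sum>k<?n. e k * cnj z ^ (?n - k)) - cnj z ^ ?n * G z)"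
        unfolding y_eq harmonic_sum_def h_def g_def
        by (simp add: field_simps del: power_Suc sum.lessThan_Suc)
      ultimately have "harmonic_sum h g z - y = cnj \<kappa> / 4 *
          ((1 - (cnj z * z) ^ ?n) * Q z + (\<Sum>k<?n. e k * (cnj z ^ (?n - k) - cnj z ^ ?n * z ^ k)))"
        by (simp add: algebra_simps sum_subtractf del: power_Suc sum.lessThan_Suc)
      also have "norm \<dots> \<le> 1 * norm ((1 - (cnj z * z) ^ ?n) * Q z + (\<Sum>k<?n. e k * (cnj z ^ (?n - k) - cnj z ^ ?n * z ^ k)))"
        unfolding norm_mult[of "cnj \<kappa> / 4"] using \<kappa> by (intro mult_right_mono) (auto simp: norm_divide)
      also have "\<dots> \<le> E (norm z)"
        unfolding E_def mult_1
      proof (intro norm_triangle_mono sum_norm_le)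
        have le1: "((norm z)\<^sup>2) ^ k \<le> 1" for k
          using z by (intro power_le_one) (auto simp: abs_square_le_1)
        have one: "norm (1 - (cnj z * z) ^ k) = 1 - ((norm z)\<^sup>2) ^ k" for k
        proof -
          have "1 - (cnj z * z) ^ k = of_real (1 - ((norm z)\<^sup>2) ^ k)" by (simp add: zz)
          then show ?thesis using le1[of k] by (simp only: norm_of_real abs_of_nonneg diff_ge_0_iff_ge)
        qed
        show "norm ((1 - (cnj z * z) ^ ?n) * Q z) \<le> (1 - ((norm z)\<^sup>2) ^ ?n) * M"
          unfolding norm_mult one using Q_le[OF zB] z r le1[of ?n] by (intro mult_left_mono) (simp_all del: power_Suc)
        fix k assume k: "k \<in> {..<?n}"
        have "cnj z ^ ?n = cnj z ^ (?n - k) * cnj z ^ k"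
          using k by (simp flip: power_add del: power_Suc)
        then have "cnj z ^ (?n - k) - cnj z ^ ?n * z ^ k = cnj z ^ (?n - k) * (1 - (cnj z * z) ^ k)"
          by (simp only: power_mult_distrib) (simp add: algebra_simps)
        then have "norm (cnj z ^ (?n - k) - cnj z ^ ?n * z ^ k) = norm z ^ (?n - k) * (1 - ((norm z)\<^sup>2) ^ k)"
          by (simp only: norm_mult one norm_power complex_mod_cnj)
        also have "\<dots> \<le> 1 * (1 - ((norm z)\<^sup>2) ^ k)"
          using z le1[of k] by (intro mult_right_mono power_le_one) auto
        finally show "norm (e k * (cnj z ^ (?n - k) - cnj z ^ ?n * z ^ k)) \<le> norm (e k) * (1 - ((norm z)\<^sup>2) ^ k)"
          unfolding norm_mult by (intro mult_left_mono) auto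
      qed
      also have "\<dots> < \<epsilon>" using r0 r z by auto
      finally show ?thesis
        using \<open>y \<in> D\<close> closure_subset by (intro bexI[of _ y]) auto
    qed
    then show "\<exists>r<1. \<forall>z. r \<le> norm z \<and> norm z < 1 \<longrightarrow> (\<exists>y\<in>closure D. norm (harmonic_sum h g z - y) \<le> \<epsilon>)"
      using r by blast
  qed simp
  then show thesis
    using that[OF h g] h0 dh dg by blast
qed

section \<open>The quadratic factor\<close>

text \<open>\<open>1 / (1 - w)\<close> maps the disc into this half-plane. It will keep the second
  linear factor from cancelling the growth caused by the first.\<close>

lemma Re_inverse_one_minus_ge:
  fixes w :: complex
  assumes "norm w < 1"
  shows "1 / 2 \<le> Re (1 / (1 - w))"
proof -
  have "Re w < 1" using assms abs_Re_le_cmod[of w] by linarith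
  have "(norm w)\<^sup>2 < 1" using assms by (simp add: abs_square_less_1)
  then have le: "(norm (1 - w))\<^sup>2 \<le> 2 * (1 - Re w)"
    unfolding cmod_power2 by (simp add: power2_eq_square algebra_simps)
  have pos: "(norm (1 - w))\<^sup>2 > 0" using \<open>Re w < 1\<close> by auto
  have "1 / 2 \<le> (1 - Re w) / (norm (1 - w))\<^sup>2"
    using le pos by (simp add: field_simps)
  also have "\<dots> = Re (1 / (1 - w))"
    by (simp add: Re_divide cmod_power2)
  finally show ?thesis .
qed

text \<open>A zero of the quadratic on the unit circle makes \<open>\<Phi>\<close> grow logarithmically along the
  radius ending there.\<close>

lemma bounded_primitive_root_inside:
  fixes \<alpha> \<beta> A :: complex
  assumes hol: "\<Phi> holomorphic_on ball 0 1" and bd: "bounded (\<Phi> ` ball 0 1)" and A: "A \<noteq> 0"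
    and eq: "\<And>z. z \<in> ball 0 1 \<Longrightarrow> deriv \<Phi> z * ((1 - \<alpha> * z) * (1 - \<beta> * z)) = A"
  shows "norm \<alpha> < 1"
proof (rule ccontr)
  assume "\<not> norm \<alpha> < 1"
  \<comment> \<open>Otherwise \<open>inverse \<gamma>\<close> lies in the disc and annihilates the
    left side of \<open>eq\<close>, although \<open>A\<close> is nonzero.\<close>
  have no_root: "norm \<gamma> \<le> 1" if "\<gamma> = \<alpha> \<or> \<gamma> = \<beta>" for \<gamma>
  proof (rule ccontr)
    assume "\<not> norm \<gamma> \<le> 1"
    then have "inverse \<gamma> \<in> ball 0 1" "\<gamma> \<noteq> 0"
      by (auto simp: norm_inverse inverse_less_1_iff)
    with eq[of "inverse \<gamma>"] that A show False by auto
  qed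
  have \<alpha>: "norm \<alpha> = 1" using no_root \<open>\<not> norm \<alpha> < 1\<close> by force
  define u where "u = cnj \<alpha>"
  have u: "\<alpha> * u = 1" "norm u = 1" "u \<noteq> 0"
    using \<alpha> complex_norm_square[of \<alpha>] by (auto simp: u_def)
  \<comment> \<open>Along the radius towards the zero \<open>u\<close>, the first term has
    derivative at least \<open>1 / (2 * (1 - r))\<close>, which the logarithm compensates exactly;
    so \<open>\<eta>\<close> cannot decrease.\<close>
  define \<eta> where "\<eta> = (\<lambda>r::real. Re (\<Phi> (of_real r * u) / (A * u)) + ln (1 - r) / 2)"
  have mono: "\<eta> 0 \<le> \<eta> r" if r: "0 \<le> r" "r < 1" for r
  proof (rule DERIV_nonneg_imp_nondecreasing[OF r(1)])
    fix x :: real assume x: "0 \<le> x" "x \<le> r"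
    have xB: "of_real x * u \<in> ball 0 1" using x r u by (simp add: norm_mult)
    have "(\<Phi> has_field_derivative deriv \<Phi> (of_real x * u)) (at (of_real x * u))"
      using holomorphic_derivI[OF hol open_ball xB] .
    then have "((\<lambda>z. \<Phi> (z * u) / (A * u)) has_field_derivative deriv \<Phi> (of_real x * u) / A) (at (of_real x))"
      using u A by (auto intro!: derivative_eq_intros DERIV_chain'[where f="\<lambda>z. z * u" and g=\<Phi>])
    then have "((\<lambda>x. \<Phi> (of_real x * u) / (A * u)) has_vector_derivative deriv \<Phi> (of_real x * u) / A) (at x)"
      by (rule has_vector_derivative_real_field)
    then have "((\<lambda>x. Re (\<Phi> (of_real x * u) / (A * u))) has_real_derivative Re (deriv \<Phi> (of_real x * u) / A)) (at x)"
      by (rule has_field_derivative_Re)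
    moreover have "((\<lambda>x. ln (1 - x) / 2) has_real_derivative - 1 / (2 * (1 - x))) (at x)"
      using x r by (auto intro!: derivative_eq_intros simp: field_simps)
    ultimately have "(\<eta> has_real_derivative Re (deriv \<Phi> (of_real x * u) / A) + - 1 / (2 * (1 - x))) (at x)"
      unfolding \<eta>_def by (rule DERIV_add)
    moreover have "1 / (2 * (1 - x)) \<le> Re (deriv \<Phi> (of_real x * u) / A)"
    proof -
      define w where "w = \<beta> * (of_real x * u)"
      have "norm w \<le> 1 * (x * 1)"
        unfolding w_def norm_mult using no_root[of \<beta>] x u by (intro mult_mono) auto
      then have w: "norm w < 1" using x r by simp
      have eqx: "deriv \<Phi> (of_real x * u) * (of_real (1 - x) * (1 - w)) = A"
        using eq[OF xB] u(1) by (simp add: w_def mult.left_commute[of \<alpha>])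
      then have "of_real (1 - x) * (1 - w) \<noteq> 0" using A by auto
      with eqx have "deriv \<Phi> (of_real x * u) = A / (of_real (1 - x) * (1 - w))"
        by (simp only: nonzero_eq_divide_eq not_False_eq_True)
      then have "deriv \<Phi> (of_real x * u) / A = (1 / (1 - x)) *\<^sub>R (1 / (1 - w))"
        using A by (simp add: scaleR_conv_of_real)
      then have "Re (deriv \<Phi> (of_real x * u) / A) = 1 / (1 - x) * Re (1 / (1 - w))"
        by (simp only: scaleR_complex.sel)
      also have "\<dots> \<ge> 1 / (1 - x) * (1 / 2)"
        using Re_inverse_one_minus_ge[OF w] x r by (intro mult_left_mono) auto
      finally show ?thesis by (simp add: field_simps)
    qed
    ultimately show "\<exists>y. (\<eta> has_real_derivative y) (at x) \<and> 0 \<le> y" by force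
  qed
  obtain R where R: "\<And>z. z \<in> ball 0 1 \<Longrightarrow> norm (\<Phi> z) \<le> R"
    using bd unfolding bounded_iff by blast
  \<comment> \<open>With this \<open>r\<close> the logarithmic term is \<open>- L\<close>, large
    enough to force \<open>\<eta> r < \<eta> 0\<close>; the maximum with 0 ensures
    \<open>0 \<le> r\<close>.\<close>
  define L where "L = max 0 (R / norm A - \<eta> 0) + 1"
  define r where "r = 1 - exp (- (2 * L))"
  have "L > 0" by (simp add: L_def)
  then have r: "0 \<le> r" "r < 1" "ln (1 - r) = - (2 * L)" by (auto simp: r_def)
  have "Re (\<Phi> (of_real r * u) / (A * u)) \<le> norm (\<Phi> (of_real r * u) / (A * u))"
    by (rule complex_Re_le_cmod)
  also have "\<dots> \<le> R / norm A"
    using R[of "of_real r * u"] r u by (simp add: norm_divide norm_mult divide_right_mono)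
  finally have "\<eta> r \<le> R / norm A - L" by (simp add: \<eta>_def r)
  also have "\<dots> < \<eta> 0" by (simp add: L_def)
  finally show False using mono[OF r(1,2)] by simp
qed

text \<open>With p and q the moduli of \<open>\<alpha>\<close> and \<open>\<beta>\<close>, the left
  side is at most \<open>p * (1 - q\<^sup>2) + q * (1 - p\<^sup>2) = (p + q) * (1 - p * q)\<close>,
  and \<open>p + q < 1 + p * q\<close> because \<open>(1 - p) * (1 - q)\<close> is positive.\<close>

lemma quadratic_coefficient_bounds:
  fixes \<alpha> \<beta> :: complex
  assumes "norm \<alpha> < 1" "norm \<beta> < 1"
  defines "a \<equiv> - (\<alpha> + \<beta>)" and "l \<equiv> \<alpha> * \<beta>"
  shows "norm l < 1" "norm (a - cnj a * l) < 1 - (norm l)\<^sup>2"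
proof -
  let ?p = "norm \<alpha>" and ?q = "norm \<beta>"
  have pq: "?p * ?q < 1"
    using assms mult_strict_mono[of ?p 1 ?q 1] by simp
  then show "norm l < 1" by (simp add: l_def norm_mult)
  have "a - cnj a * l = - (\<alpha> * of_real (1 - ?q\<^sup>2) + \<beta> * of_real (1 - ?p\<^sup>2))"
    unfolding a_def l_def of_real_diff complex_norm_square by (simp add: algebra_simps)
  then have "norm (a - cnj a * l) \<le> norm (\<alpha> * of_real (1 - ?q\<^sup>2)) + norm (\<beta> * of_real (1 - ?p\<^sup>2))"
    by (metis norm_minus_cancel norm_triangle_ineq)
  also have "\<dots> = ?p * (1 - ?q\<^sup>2) + ?q * (1 - ?p\<^sup>2)"
    using assms unfolding norm_mult norm_of_real by (simp add: abs_square_le_1 less_imp_le)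
  also have "\<dots> = (?p + ?q) * (1 - ?p * ?q)"
    by (simp add: power2_eq_square algebra_simps)
  also have "\<dots> < (1 + ?p * ?q) * (1 - ?p * ?q)"
  proof (rule mult_strict_right_mono)
    have "0 < (1 - ?p) * (1 - ?q)" using assms by simp
    then show "?p + ?q < 1 + ?p * ?q" by (simp add: algebra_simps)
  qed (use pq in simp)
  also have "\<dots> = 1 - (norm l)\<^sup>2"
    by (simp add: l_def norm_mult power2_eq_square algebra_simps)
  finally show "norm (a - cnj a * l) < 1 - (norm l)\<^sup>2" .
qed

text \<open>\<open>\<alpha>\<close> and \<open>\<beta>\<close> are reciprocals of the zeros of
  \<open>1 + a * z + l * z\<^sup>2\<close>; this form also covers \<open>l = 0\<close>, where the
  degree drops.\<close>

lemma quadratic_factorization: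
  fixes a l :: complex
  obtains \<alpha> \<beta> where "a = - (\<alpha> + \<beta>)" "l = \<alpha> * \<beta>"
proof
  let ?s = "csqrt (a\<^sup>2 - 4 * l)"
  show "a = - ((- a + ?s) / 2 + (- a - ?s) / 2)" by (simp add: field_simps)
  have "(- a + ?s) / 2 * ((- a - ?s) / 2) = (a\<^sup>2 - ?s\<^sup>2) / 4"
    by (simp add: power2_eq_square field_simps)
  then show "l = (- a + ?s) / 2 * ((- a - ?s) / 2)" by simp
qed

section \<open>The extremal map\<close>

text \<open>Scaling by \<open>t < 1\<close> moves the closure into \<open>D\<close>, as 0 is an
  interior point. The functional is real linear, so the bound survives \<open>t\<close> tending to
  1.\<close>

lemma harmonic_functional_le_closure:
  assumes D: "open D" "convex D" "0 \<in> D"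
    and le: "\<And>h g. h holomorphic_on ball 0 1 \<Longrightarrow> g holomorphic_on ball 0 1 \<Longrightarrow> harmonic_sum h g ` ball 0 1 \<subseteq> D \<Longrightarrow>
       Re (\<gamma>0 * harmonic_sum h g 0 + \<gamma>1 * deriv h 0 + \<gamma>2 * cnj (deriv g 0)) \<le> S"
    and hg: "h holomorphic_on ball 0 1" "g holomorphic_on ball 0 1"
    and sub: "harmonic_sum h g ` ball 0 1 \<subseteq> closure D"
  shows "Re (\<gamma>0 * harmonic_sum h g 0 + \<gamma>1 * deriv h 0 + \<gamma>2 * cnj (deriv g 0)) \<le> S" (is "?L \<le> S")
proof -
  have scaled: "t * ?L \<le> S" if t: "0 < t" "t < 1" for t :: real
  proof -
    let ?h = "\<lambda>z. of_real t * h z" and ?g = "\<lambda>z. of_real t * g z"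
    have hs: "harmonic_sum ?h ?g z = t *\<^sub>R harmonic_sum h g z" for z
      by (simp add: harmonic_sum_def scaleR_conv_of_real algebra_simps)
    have "t *\<^sub>R y \<in> D" if "y \<in> closure D" for y
    proof (cases "y = 0")
      case False
      then have "t *\<^sub>R y \<in> open_segment 0 y"
        using t by (auto simp: in_segment)
      then show ?thesis
        using in_interior_closure_convex_segment[OF D(2), of 0 y] D that interior_open by auto
    qed (use D in simp)
    then have "harmonic_sum ?h ?g ` ball 0 1 \<subseteq> D"
      using sub by (auto simp: hs)
    moreover have "(h has_field_derivative deriv h 0) (at 0)" "(g has_field_derivative deriv g 0) (at 0)"
      using hg by (auto intro!: holomorphic_derivI[of _ "ball 0 1"])
    then have "deriv ?h 0 = of_real t * deriv h 0" "deriv ?g 0 = of_real t * deriv g 0"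
      by (auto intro!: DERIV_imp_deriv DERIV_cmult)
    ultimately show ?thesis
      using le[of ?h ?g] hg by (simp add: holomorphic_intros hs algebra_simps)
  qed
  show ?thesis
  proof (rule tendsto_upperbound)
    show "((\<lambda>t. t * ?L) \<longlongrightarrow> ?L) (at_left 1)"
      by (rule tendsto_eq_intros refl | simp)+
    show "\<forall>\<^sub>F t in at_left 1. t * ?L \<le> S"
      using scaled unfolding eventually_at_left_field by (intro exI[of _ 0]) simp
  qed simp
qed

text \<open>The functional is maximal at the rotation angle \<open>s = 0\<close>, so its derivative in \<open>s\<close>
  vanishes there for every weight \<open>\<kappa>\<close>.\<close>

lemma extremal_coefficient_recurrence:
  fixes A :: "nat \<Rightarrow> complex"
  assumes D: "open D" "convex D" "bounded D" "0 \<in> D"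
    and ser: "\<And>z. z \<in> ball 0 1 \<Longrightarrow> (\<lambda>k. A k * z ^ k) sums \<Phi> z" and A0: "A 0 = 0"
    and sub: "\<Phi> ` ball 0 1 \<subseteq> D"
    and le: "\<And>h g. h holomorphic_on ball 0 1 \<Longrightarrow> g holomorphic_on ball 0 1 \<Longrightarrow> harmonic_sum h g ` ball 0 1 \<subseteq> D \<Longrightarrow>
       Re (\<gamma>0 * harmonic_sum h g 0 + \<gamma>1 * deriv h 0 + \<gamma>2 * cnj (deriv g 0)) \<le> Re (\<gamma>1 * A 1)"
  shows
    "\<gamma>1 * (of_nat (m + 2) * A (m + 2)) + \<gamma>0 * (of_nat (m + 1) * A (m + 1)) + \<gamma>2 * (of_nat m * A m) = 0"
      (is "?X = 0")
proof -
  have stat: "Re (\<i> * (\<gamma>1 * A 1 / 2 + cnj \<kappa> / 4 * ?X)) = 0" if \<kappa>: "norm \<kappa> \<le> 1" for \<kappa>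
  proof -
    define e where "e = (\<lambda>s k. A k * (cis s ^ k - 1))"
    define \<phi> where "\<phi> = (\<lambda>s. Re (\<gamma>0 * (A 0 + cnj \<kappa> / 4 * e s (Suc m))
        + \<gamma>1 * (A 1 + e s 1 / 2 + cnj \<kappa> / 4 * e s (Suc (Suc m))) + \<gamma>2 * (cnj \<kappa> / 4 * e s m)))"
    have "\<phi> s \<le> Re (\<gamma>1 * A 1)" for s
    proof -
      obtain h g where hg: "h holomorphic_on ball 0 1" "g holomorphic_on ball 0 1"
        "harmonic_sum h g ` ball 0 1 \<subseteq> closure D"
        "harmonic_sum h g 0 = A 0 + cnj \<kappa> / 4 * e s (Suc m)"
        "deriv h 0 = A 1 + e s 1 / 2 + cnj \<kappa> / 4 * e s (Suc (Suc m))"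
        "cnj (deriv g 0) = cnj \<kappa> / 4 * e s m"
        unfolding e_def using randomly_rotated_competitor[OF ser sub D(2,3) \<kappa>] by blast
      show ?thesis
        using harmonic_functional_le_closure[OF D(1,2,4) le hg(1-3)] unfolding \<phi>_def hg(4-6) .
    qed
    moreover have "\<phi> 0 = Re (\<gamma>1 * A 1)" by (simp add: \<phi>_def e_def A0)
    ultimately have max: "\<phi> s \<le> \<phi> 0" for s by simp
    have de: "((\<lambda>s. e s k) has_vector_derivative \<i> * (of_nat k * A k)) (at 0)" for k
    proof -
      have "((\<lambda>z. A k * (exp (\<i> * z) ^ k - 1)) has_field_derivative \<i> * (of_nat k * A k)) (at (of_real 0))"
        by (auto intro!: derivative_eq_intros)
      from has_vector_derivative_real_field[OF this] show ?thesis
        by (simp add: e_def cis_conv_exp)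
    qed
    have "((\<lambda>s. \<gamma>0 * (A 0 + cnj \<kappa> / 4 * e s (Suc m))
        + \<gamma>1 * (A 1 + e s 1 / 2 + cnj \<kappa> / 4 * e s (Suc (Suc m))) + \<gamma>2 * (cnj \<kappa> / 4 * e s m))
       has_vector_derivative \<i> * (\<gamma>1 * A 1 / 2 + cnj \<kappa> / 4 * ?X)) (at 0)"
      by (rule derivative_eq_intros de refl)+ (simp add: field_simps)
    then have "(\<phi> has_real_derivative Re (\<i> * (\<gamma>1 * A 1 / 2 + cnj \<kappa> / 4 * ?X))) (at 0)"
      unfolding \<phi>_def by (rule has_field_derivative_Re)
    then show ?thesis
      by (rule DERIV_local_max[of _ _ _ 1]) (use max in auto)
  qed
  \<comment> \<open>The weight \<open>\<kappa> = 0\<close> shows that \<open>\<gamma>1 * A 1\<close>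
    is real, so this term drops out for the other weights. Then \<open>\<kappa> = 1\<close> and
    \<open>\<kappa> = \<i>\<close> give the imaginary and the real part of
    \<open>?X\<close>.\<close>
  have im: "Im (\<gamma>1 * A 1) = 0" using stat[of 0] by (simp del: times_complex.sel add: Im_divide_numeral)
  have "Re (\<i> * (\<gamma>1 * A 1 / 2 + Z)) = - Im Z" for Z
    using im by (simp only: distrib_left plus_complex.sel Re_i_times Im_divide_numeral)
  then have "Im (cnj \<kappa> / 4 * ?X) = 0" if "norm \<kappa> \<le> 1" for \<kappa>
    using stat[OF that] by simp
  from this[of 1] this[of \<i>] show "?X = 0"
    by (simp add: complex_eq_iff del: of_nat_add)
qed

text \<open>\<open>rec\<close> at \<open>m\<close> says that the coefficient of
  \<open>z ^ (m + 1)\<close> in the product vanishes, so only the constant term is left.\<close>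

lemma extremal_deriv_times_quadratic:
  fixes A :: "nat \<Rightarrow> complex"
  assumes hol: "\<Phi> holomorphic_on ball 0 1" and A: "\<And>k. A k = (deriv ^^ k) \<Phi> 0 / fact k"
    and rec: "\<And>m. \<gamma>1 * (of_nat (m + 2) * A (m + 2)) + \<gamma>0 * (of_nat (m + 1) * A (m + 1)) + \<gamma>2 * (of_nat m * A m) = 0"
    and z: "z \<in> ball 0 1"
  shows "deriv \<Phi> z * (\<gamma>1 + \<gamma>0 * z + \<gamma>2 * z\<^sup>2) = \<gamma>1 * A 1"
proof -
  define d where "d = (\<lambda>k. of_nat (k + 1) * A (k + 1))"
  have "(deriv ^^ k) (deriv \<Phi>) 0 / fact k = d k" for k
    by (simp add: d_def A funpow_swap1 fact_reduce del: of_nat_Suc of_nat_add)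
  then have s0: "(\<lambda>k. d k * z ^ k) sums deriv \<Phi> z"
    using holomorphic_power_series[OF holomorphic_deriv[OF hol open_ball] z] by simp
  then have s1: "(\<lambda>k. d (k + 1) * z ^ (k + 1)) sums (deriv \<Phi> z - A 1)"
    using sums_Suc_iff[of "\<lambda>k. d k * z ^ k" "deriv \<Phi> z - A 1"] by (simp add: d_def)
  have s2: "(\<lambda>k. d k * z ^ (k + 1)) sums (z * deriv \<Phi> z)"
    using sums_mult[OF s0, of z] by (simp add: mult_ac)
  \<comment> \<open>Adding the zero term \<open>k = 0\<close> aligns the third series with the other
    two: all carry \<open>z ^ (k + 1)\<close>.\<close>
  have "(\<lambda>k. of_nat (Suc k) * A (Suc k) * z ^ Suc k) sums (z * deriv \<Phi> z)"
    using s2 by (simp add: d_def)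
  then have "(\<lambda>k. of_nat k * A k * z ^ k) sums (z * deriv \<Phi> z)"
    by (subst (asm) sums_Suc_iff) simp
  from sums_mult[OF this, of z] have s3: "(\<lambda>k. of_nat k * A k * z ^ (k + 1)) sums (z * (z * deriv \<Phi> z))"
    by (simp add: mult_ac)
  have "(\<lambda>k. \<gamma>1 * (d (k + 1) * z ^ (k + 1)) + \<gamma>0 * (d k * z ^ (k + 1)) + \<gamma>2 * (of_nat k * A k * z ^ (k + 1)))
     sums (\<gamma>1 * (deriv \<Phi> z - A 1) + \<gamma>0 * (z * deriv \<Phi> z) + \<gamma>2 * (z * (z * deriv \<Phi> z)))"
    by (intro sums_add sums_mult s1 s2 s3)
  moreover have "\<gamma>1 * (d (k + 1) * z ^ (k + 1)) + \<gamma>0 * (d k * z ^ (k + 1)) + \<gamma>2 * (of_nat k * A k * z ^ (k + 1)) = 0" for k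
  proof -
    have "\<gamma>1 * (d (k + 1) * z ^ (k + 1)) + \<gamma>0 * (d k * z ^ (k + 1)) + \<gamma>2 * (of_nat k * A k * z ^ (k + 1))
      = (\<gamma>1 * d (k + 1) + \<gamma>0 * d k + \<gamma>2 * (of_nat k * A k)) * z ^ (k + 1)"
      by (simp add: algebra_simps)
    also have "\<dots> = 0" using rec[of k] by (simp add: d_def numeral_2_eq_2)
    finally show ?thesis .
  qed
  ultimately have "\<gamma>1 * (deriv \<Phi> z - A 1) + \<gamma>0 * (z * deriv \<Phi> z) + \<gamma>2 * (z * (z * deriv \<Phi> z)) = 0"
    using sums_unique2[OF _ sums_zero] by simp
  moreover have "deriv \<Phi> z * (\<gamma>1 + \<gamma>0 * z + \<gamma>2 * z\<^sup>2) - \<gamma>1 * A 1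
      = \<gamma>1 * (deriv \<Phi> z - A 1) + \<gamma>0 * (z * deriv \<Phi> z) + \<gamma>2 * (z * (z * deriv \<Phi> z))"
    by (simp add: algebra_simps power2_eq_square)
  ultimately show ?thesis by simp
qed

theorem theorem1p2:
  fixes D :: "complex set" and \<Phi> :: "complex \<Rightarrow> complex"
  assumes "open D" "connected D" "bounded D" "convex D"
    and "\<Phi> holomorphic_on ball 0 1" "inj_on \<Phi> (ball 0 1)" "\<Phi> ` ball 0 1 = D"
    and "\<Phi> 0 = 0" and "norm (deriv \<Phi> 0) = M_dom D 0"
  shows "\<exists>\<theta>::real. \<exists>c::real. \<exists>a lam::complex.
           c > 0 \<and> norm lam < 1 \<and> norm (a - cnj a * lam) < 1 - (norm lam)\<^sup>2 \<and>
           (let F = (\<lambda>z. exp (\<i> * of_real \<theta>) * \<Phi> z) in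
              F 0 = 0 \<and>
              (\<forall>z\<in>ball 0 1. deriv F z = of_real c / (1 + a * z + lam * z\<^sup>2)))"
proof -
  note hol = \<open>\<Phi> holomorphic_on ball 0 1\<close>
  define A where "A = deriv \<Phi> 0"
  define C where "C = (\<lambda>k. (deriv ^^ k) \<Phi> 0 / fact k)"
  have C: "C 0 = 0" "C 1 = A" using \<open>\<Phi> 0 = 0\<close> by (simp_all add: C_def A_def)
  have "A \<noteq> 0"
    unfolding A_def using holomorphic_injective_imp_regular[OF hol open_ball \<open>inj_on \<Phi> (ball 0 1)\<close>, of 0] by simp
  have "0 \<in> D" using \<open>\<Phi> 0 = 0\<close> \<open>\<Phi> ` ball 0 1 = D\<close> by (metis centre_in_ball imageI zero_less_one)
  obtain \<gamma>0 \<gamma>1 \<gamma>2 where \<gamma>: "Re (\<gamma>1 * A) > 0"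
    and le: "\<And>h g. h holomorphic_on ball 0 1 \<Longrightarrow> g holomorphic_on ball 0 1 \<Longrightarrow> harmonic_sum h g ` ball 0 1 \<subseteq> D \<Longrightarrow>
       Re (\<gamma>0 * harmonic_sum h g 0 + \<gamma>1 * deriv h 0 + \<gamma>2 * cnj (deriv g 0)) \<le> Re (\<gamma>1 * A)"
    by (rule extremal_multipliers[OF assms(1,4,3) \<open>0 \<in> D\<close> assms(9)[folded A_def] \<open>A \<noteq> 0\<close>])
      (rule that, assumption, blast)
  have "(\<lambda>k. C k * z ^ k) sums \<Phi> z" if "z \<in> ball 0 1" for z
    using holomorphic_power_series[OF hol that] by (simp add: C_def)
  note rec = extremal_coefficient_recurrence[OF assms(1,4,3) \<open>0 \<in> D\<close> this C(1) eq_refl[OF assms(7)] le[folded C(2)]]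
  define a l where "a = \<gamma>0 / \<gamma>1" and "l = \<gamma>2 / \<gamma>1"
  have "\<gamma>1 \<noteq> 0" using \<gamma> by auto
  have quad: "deriv \<Phi> z * (1 + a * z + l * z\<^sup>2) = A" if "z \<in> ball 0 1" for z
  proof -
    have "deriv \<Phi> z * (\<gamma>1 + \<gamma>0 * z + \<gamma>2 * z\<^sup>2) = \<gamma>1 * A"
      using extremal_deriv_times_quadratic[OF hol C_def[THEN fun_cong] rec that] unfolding C .
    moreover have "\<gamma>1 + \<gamma>0 * z + \<gamma>2 * z\<^sup>2 = \<gamma>1 * (1 + a * z + l * z\<^sup>2)"
      using \<open>\<gamma>1 \<noteq> 0\<close> by (simp add: a_def l_def field_simps)
    ultimately show ?thesis using \<open>\<gamma>1 \<noteq> 0\<close> by simp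
  qed
  obtain \<alpha> \<beta> where ab: "a = - (\<alpha> + \<beta>)" "l = \<alpha> * \<beta>" by (rule quadratic_factorization)
  \<comment> \<open>Both orders are recorded since the root lemma bounds only the first
    parameter.\<close>
  have factored: "deriv \<Phi> z * ((1 - \<alpha> * z) * (1 - \<beta> * z)) = A" "deriv \<Phi> z * ((1 - \<beta> * z) * (1 - \<alpha> * z)) = A"
    if "z \<in> ball 0 1" for z
    using quad[OF that] by (simp_all add: ab power2_eq_square algebra_simps)
  have bd: "bounded (\<Phi> ` ball 0 1)" using assms by simp
  have "norm \<alpha> < 1" "norm \<beta> < 1"
    using bounded_primitive_root_inside[OF hol bd \<open>A \<noteq> 0\<close>] factored by blast+
  then have bounds: "norm l < 1" "norm (a - cnj a * l) < 1 - (norm l)\<^sup>2"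
    unfolding ab by (rule quadratic_coefficient_bounds)+
  \<comment> \<open>This rotation cancels the argument of \<open>A\<close>, so that \<open>c\<close>
    becomes \<open>norm A\<close>.\<close>
  define \<theta> where "\<theta> = - Arg A"
  have rot: "exp (\<i> * of_real \<theta>) * A = of_real (norm A)"
  proof -
    have "A = of_real (norm A) * exp (\<i> * of_real (Arg A))" using \<open>A \<noteq> 0\<close> by (rule Arg_eq)
    then have "exp (\<i> * of_real \<theta>) * A = of_real (norm A) * (exp (\<i> * of_real (Arg A)) * exp (\<i> * of_real \<theta>))"
      by (metis mult.assoc mult.commute)
    also have "exp (\<i> * of_real (Arg A)) * exp (\<i> * of_real \<theta>) = 1"
      by (simp add: \<theta>_def flip: exp_add)
    finally show ?thesis by simp
  qed
  have "deriv (\<lambda>z. exp (\<i> * of_real \<theta>) * \<Phi> z) z = of_real (norm A) / (1 + a * z + l * z\<^sup>2)"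
    if z: "z \<in> ball 0 1" for z
  proof -
    have "1 + a * z + l * z\<^sup>2 \<noteq> 0" using quad[OF z] \<open>A \<noteq> 0\<close> by auto
    then have "deriv \<Phi> z = A / (1 + a * z + l * z\<^sup>2)"
      using quad[OF z] by (simp add: eq_divide_eq)
    moreover have "deriv (\<lambda>z. exp (\<i> * of_real \<theta>) * \<Phi> z) z = exp (\<i> * of_real \<theta>) * deriv \<Phi> z"
      by (intro DERIV_imp_deriv DERIV_cmult holomorphic_derivI[OF hol open_ball z])
    ultimately show ?thesis using rot by simp
  qed
  then show ?thesis
    using bounds \<open>A \<noteq> 0\<close> \<open>\<Phi> 0 = 0\<close>
    by (intro exI[of _ \<theta>] exI[of _ "norm A"] exI[of _ a] exI[of _ l]) (simp add: Let_def)
qed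

end
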